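(* There exists a universal constant $K>0$ such that for every $n\in\mathbb{N}$ and every projection $T\in \mathbb{M}_{2^{n}}$, $$\mathrm{var}(T)\sqrt{\log\left(\frac{1}{\mathrm{var}(T)}\right)}\;\le\; K\left\|\left(\sum_{j=1}^{n}|\mathbf{d}_{j}(T)|^{2}\right)^{1/2}\right\|_{L_{1}},$$ where the left-hand side is read as $0$ if $\mathrm{var}(T)=0$.
   Context: $n\ge 1$ is an integer, $[n]=\{1,\dots,n\}$. $\mathbb{M}_{2^n}=M_2(\mathbb{C})^{\otimes n}$ is the algebra of complex $2^n\times 2^n$ matrices with unit $\mathbf{1}$, equipped with the normalized trace $\mathrm{tr}$ (so $\mathrm{tr}(\mathbf{1})=1$). A projection is $T$ with $T^*=T=T^2$. $|T|=(T^*T)^{1/2}$, and for $1\le p<\infty$, $\|T\|_{L_p}=(\mathrm{tr}(|T|^p))^{1/p}$. The variance is $\mathrm{var}(T)=\mathrm{tr}(|T|^2)-|\mathrm{tr}(T)|^2$. The $j$-th partial derivative is the linear map $\mathbf{d}_j=\mathrm{id}^{\otimes(j-1)}\otimes D\otimes \mathrm{id}^{\otimes(n-j)}$ on $\mathbb{M}_{2^n}$, where $D:M_2(\mathbb{C})\to M_2(\mathbb{C})$ is $D(A)=A-\mathrm{tr}(A)\mathbf{1}_2$ ($\mathrm{tr}$ being the normalized trace on $M_2(\mathbb{C})$). Here $|\mathbf{d}_j(T)|^2=\mathbf{d}_j(T)^*\mathbf{d}_j(T)$. *)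

theory Defs
  imports Complex_Main "Jordan_Normal_Form.Schur_Decomposition"
begin

text \<open>
  The algebra of \<open>2^n \<times> 2^n\<close> complex matrices is \<open>carrier_mat (2^n) (2^n)\<close>; it is identified
  with the \<open>n\<close>-fold tensor power of the \<open>2 \<times> 2\<close> matrices by the Kronecker product.
\<close>

definition ntr :: "complex mat \<Rightarrow> complex" where
  "ntr A = (\<Sum>i<dim_row A. A $$ (i, i)) / of_nat (dim_row A)"

definition unitary_mat :: "nat \<Rightarrow> complex mat \<Rightarrow> bool" where
  "unitary_mat n U \<longleftrightarrow>
     U \<in> carrier_mat n n \<and> mat_adjoint U * U = 1\<^sub>m n \<and> U * mat_adjoint U = 1\<^sub>m n"

definition is_projection :: "nat \<Rightarrow> complex mat \<Rightarrow> bool" where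
  "is_projection N T \<longleftrightarrow> T \<in> carrier_mat N N \<and> mat_adjoint T = T \<and> T * T = T"

text \<open>
  Real powers of positive semidefinite matrices by spectral calculus: if
  \<open>A = U diag(d) U\<^sup>*\<close> with \<open>U\<close> unitary and \<open>d \<ge> 0\<close>, then \<open>A\<^sup>p = U diag(d\<^sup>p) U\<^sup>*\<close>. The result does
  not depend on the diagonalisation (\<open>mat_powr_rel_unique\<close>). It is meant for \<open>p > 0\<close>
  (\<open>0 powr p = 0\<close>), and is unspecified if \<open>A\<close> is not positive semidefinite.
\<close>

definition mat_powr_rel :: "complex mat \<Rightarrow> real \<Rightarrow> complex mat \<Rightarrow> bool" where
  "mat_powr_rel A p B \<longleftrightarrow>
     (\<exists>n U (d :: nat \<Rightarrow> real). unitary_mat n U \<and> (\<forall>i<n. 0 \<le> d i) \<and>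
        A = U * mat_diag n (\<lambda>i. complex_of_real (d i)) * mat_adjoint U \<and>
        B = U * mat_diag n (\<lambda>i. complex_of_real (d i powr p)) * mat_adjoint U)"

definition mat_powr :: "complex mat \<Rightarrow> real \<Rightarrow> complex mat" where
  "mat_powr A p = (THE B. mat_powr_rel A p B)"

lemma mat_powr_rel_unique:
  assumes "mat_powr_rel A p B" "mat_powr_rel A p B'"
  shows "B = B'"
proof -
  let ?dg = "\<lambda>n (d :: nat \<Rightarrow> real). mat_diag n (\<lambda>i. complex_of_real (d i))"
  obtain n U d where U: "unitary_mat n U" and d: "\<forall>i<n. 0 \<le> d i"
    and A: "A = U * ?dg n d * mat_adjoint U"
    and B: "B = U * ?dg n (\<lambda>i. d i powr p) * mat_adjoint U"
    using assms(1) unfolding mat_powr_rel_def by blast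
  obtain m V e where V: "unitary_mat m V" and e: "\<forall>i<m. 0 \<le> e i"
    and A': "A = V * ?dg m e * mat_adjoint V"
    and B': "B' = V * ?dg m (\<lambda>i. e i powr p) * mat_adjoint V"
    using assms(2) unfolding mat_powr_rel_def by blast
  have "dim_row A = n" using U by (auto simp: A unitary_mat_def)
  moreover have "dim_row A = m" using V by (auto simp: A' unitary_mat_def)
  ultimately have m: "m = n" by simp
  note V = V[unfolded m] and A' = A'[unfolded m] and B' = B'[unfolded m]
  have adj: "mat_adjoint X \<in> carrier_mat n n" if "X \<in> carrier_mat n n" for X :: "complex mat"
    using that by (auto simp: mat_adjoint_def)
  have Uc[simp]: "U \<in> carrier_mat n n" "mat_adjoint U \<in> carrier_mat n n"
    and Vc[simp]: "V \<in> carrier_mat n n" "mat_adjoint V \<in> carrier_mat n n"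
    and U1: "mat_adjoint U * U = 1\<^sub>m n" "U * mat_adjoint U = 1\<^sub>m n"
    and V1: "mat_adjoint V * V = 1\<^sub>m n" "V * mat_adjoint V = 1\<^sub>m n"
    using U V adj unfolding unitary_mat_def by auto
  note [simp] = mult_carrier_mat[of _ n n _ n] and as = assoc_mult_mat[of _ n n _ n _ n] right_mult_one_mat[of _ n n]
    left_mult_one_mat[of _ n n]
  define W where "W = mat_adjoint V * U"
  have W[simp]: "W \<in> carrier_mat n n" unfolding W_def by simp
  have 1: "mat_adjoint V * A * U = W * ?dg n d"
    unfolding A W_def by (simp add: as U1)
  have 2: "mat_adjoint V * A * U = ?dg n e * W"
  proof -
    have "mat_adjoint V * A * U = (mat_adjoint V * V) * (?dg n e * (mat_adjoint V * U))"
      unfolding A' by (simp add: as)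
    then show ?thesis by (simp add: V1 W_def as)
  qed
  have eq: "W $$ (i, j) * d j = e i * W $$ (i, j)" if "i < n" "j < n" for i j
    using arg_cong[OF trans[OF 1[symmetric] 2], of "\<lambda>X. X $$ (i, j)"] that
    by (simp add: mat_diag_mult_left[of _ n n] mat_diag_mult_right[of _ n n])
  have "W $$ (i, j) * (d j powr p) = (e i powr p) * W $$ (i, j)" if "i < n" "j < n" for i j
    using eq[OF that] by (cases "W $$ (i, j) = 0") (auto simp: mult.commute)
  then have 3: "W * ?dg n (\<lambda>i. d i powr p) = ?dg n (\<lambda>i. e i powr p) * W"
    by (intro eq_matI) (auto simp: mat_diag_mult_left[of _ n n] mat_diag_mult_right[of _ n n])
  have "B = (V * mat_adjoint V) * B" unfolding V1 B by (simp add: as)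
  also have "\<dots> = V * (W * ?dg n (\<lambda>i. d i powr p)) * mat_adjoint U"
    unfolding B W_def by (simp add: as)
  also have "\<dots> = V * ?dg n (\<lambda>i. e i powr p) * mat_adjoint V * (U * mat_adjoint U)"
    unfolding 3 unfolding W_def by (simp add: as)
  also have "\<dots> = B'" unfolding U1 B' by (simp add: as)
  finally show ?thesis .
qed

lemma mat_powr_eqI: "mat_powr_rel A p B \<Longrightarrow> mat_powr A p = B"
  unfolding mat_powr_def using mat_powr_rel_unique by (intro the_equality)

definition mat_abs :: "complex mat \<Rightarrow> complex mat" where
  "mat_abs T = mat_powr (mat_adjoint T * T) (1 / 2)"

text \<open>The trace below is real and nonnegative, so \<open>Re\<close> only changes the type.\<close>

definition Lp_norm :: "real \<Rightarrow> complex mat \<Rightarrow> real" where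
  "Lp_norm p T = Re (ntr (mat_powr (mat_abs T) p)) powr (1 / p)"

definition var :: "complex mat \<Rightarrow> real" where
  "var T = Re (ntr (mat_abs T ^\<^sub>m 2)) - (cmod (ntr T))\<^sup>2"

definition kron :: "complex mat \<Rightarrow> complex mat \<Rightarrow> complex mat" where
  "kron A B = mat (dim_row A * dim_row B) (dim_col A * dim_col B)
     (\<lambda>(r, c). A $$ (r div dim_row B, c div dim_col B) * B $$ (r mod dim_row B, c mod dim_col B))"

definition munit :: "nat \<Rightarrow> nat \<Rightarrow> nat \<Rightarrow> complex mat" where
  "munit N i j = mat N N (\<lambda>rc. if rc = (i, j) then 1 else 0)"

text \<open>
  The tensor product \<open>\<Phi> \<otimes> \<Psi>\<close> of linear maps \<open>\<Phi>\<close> on \<open>a \<times> a\<close> and \<open>\<Psi>\<close> on \<open>b \<times> b\<close> matrices, as the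
  linear map on \<open>ab \<times> ab\<close> matrices which sends each matrix unit \<open>E\<^sub>i\<^sub>j \<otimes> E\<^sub>k\<^sub>l\<close> (the one at position
  \<open>(i b + k, j b + l)\<close>) to \<open>\<Phi> E\<^sub>i\<^sub>j \<otimes> \<Psi> E\<^sub>k\<^sub>l\<close>.
\<close>

definition tensor_map ::
  "nat \<Rightarrow> nat \<Rightarrow> (complex mat \<Rightarrow> complex mat) \<Rightarrow> (complex mat \<Rightarrow> complex mat) \<Rightarrow> complex mat \<Rightarrow> complex mat"
  where
  "tensor_map a b \<Phi> \<Psi> X = mat (a * b) (a * b) (\<lambda>rc.
     \<Sum>i<a. \<Sum>j<a. \<Sum>k<b. \<Sum>l<b.
       X $$ (i * b + k, j * b + l) * kron (\<Phi> (munit a i j)) (\<Psi> (munit b k l)) $$ rc)"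

lemma tensor_map_kron:
  assumes A: "A \<in> carrier_mat a a" and B: "B \<in> carrier_mat b b"
    and Phi: "\<And>X. X \<in> carrier_mat a a \<Longrightarrow> \<Phi> X \<in> carrier_mat a a"
    and Psi: "\<And>X. X \<in> carrier_mat b b \<Longrightarrow> \<Psi> X \<in> carrier_mat b b"
    and Phi_lin: "\<And>r c. r < a \<Longrightarrow> c < a \<Longrightarrow>
      \<Phi> A $$ (r, c) = (\<Sum>i<a. \<Sum>j<a. A $$ (i, j) * \<Phi> (munit a i j) $$ (r, c))"
    and Psi_lin: "\<And>r c. r < b \<Longrightarrow> c < b \<Longrightarrow>
      \<Psi> B $$ (r, c) = (\<Sum>k<b. \<Sum>l<b. B $$ (k, l) * \<Psi> (munit b k l) $$ (r, c))"
  shows "tensor_map a b \<Phi> \<Psi> (kron A B) = kron (\<Phi> A) (\<Psi> B)"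
proof (rule eq_matI)
  have mu: "munit N i j \<in> carrier_mat N N" for N i j by (simp add: munit_def)
  note dims = carrier_matD[OF Phi[OF mu]] carrier_matD[OF Psi[OF mu]]
    carrier_matD[OF Phi[OF A]] carrier_matD[OF Psi[OF B]] carrier_matD[OF A] carrier_matD[OF B]
  show "dim_row (tensor_map a b \<Phi> \<Psi> (kron A B)) = dim_row (kron (\<Phi> A) (\<Psi> B))"
    "dim_col (tensor_map a b \<Phi> \<Psi> (kron A B)) = dim_col (kron (\<Phi> A) (\<Psi> B))"
    by (simp_all add: tensor_map_def kron_def dims)
  fix r c assume "r < dim_row (kron (\<Phi> A) (\<Psi> B))" "c < dim_col (kron (\<Phi> A) (\<Psi> B))"
  then have rc: "r < a * b" "c < a * b" by (simp_all add: kron_def dims)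
  then have b: "b > 0" by (auto intro: gr0I)
  have q: "r div b < a" "c div b < a" "r mod b < b" "c mod b < b"
    using rc b by (auto simp: less_mult_imp_div_less)
  have pos: "i * b + k < a * b" if "i < a" "k < b" for i k
    using mult_le_mono1[of "Suc i" a b] that by simp
  have "tensor_map a b \<Phi> \<Psi> (kron A B) $$ (r, c) =
      (\<Sum>i<a. \<Sum>j<a. \<Sum>k<b. \<Sum>l<b. (A $$ (i, j) * \<Phi> (munit a i j) $$ (r div b, c div b)) *
        (B $$ (k, l) * \<Psi> (munit b k l) $$ (r mod b, c mod b)))"
    using rc unfolding tensor_map_def
    by (auto simp: kron_def dims pos intro!: sum.cong)
  also have "\<dots> = \<Phi> A $$ (r div b, c div b) * \<Psi> B $$ (r mod b, c mod b)"
    unfolding Phi_lin[OF q(1,2)] Psi_lin[OF q(3,4)]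
    by (subst sum_distrib_right, subst sum_distrib_right) (simp only: sum_distrib_left)
  also have "\<dots> = kron (\<Phi> A) (\<Psi> B) $$ (r, c)"
    using rc by (simp add: kron_def dims)
  finally show "tensor_map a b \<Phi> \<Psi> (kron A B) $$ (r, c) = kron (\<Phi> A) (\<Psi> B) $$ (r, c)" .
qed

definition D_map :: "complex mat \<Rightarrow> complex mat" where
  "D_map A = A - ntr A \<cdot>\<^sub>m 1\<^sub>m 2"

text \<open>\<open>id\<^sup>\<otimes>\<^sup>(\<^sup>j\<^sup>-\<^sup>1\<^sup>) \<otimes> D \<otimes> id\<^sup>\<otimes>\<^sup>(\<^sup>n\<^sup>-\<^sup>j\<^sup>)\<close>, for \<open>1 \<le> j \<le> n\<close>.\<close>

definition partial_d :: "nat \<Rightarrow> nat \<Rightarrow> complex mat \<Rightarrow> complex mat" where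
  "partial_d n j =
     tensor_map (2 ^ (j - 1)) (2 * 2 ^ (n - j)) id (tensor_map 2 (2 ^ (n - j)) D_map id)"

lemma partial_d_carrier:
  assumes "1 \<le> j" "j \<le> n"
  shows "partial_d n j T \<in> carrier_mat (2 ^ n) (2 ^ n)"
proof -
  have "(2::nat) ^ (j - 1) * (2 * 2 ^ (n - j)) = 2 ^ n"
    using assms by (simp only: power_Suc[symmetric] power_add[symmetric]) simp
  then show ?thesis by (simp add: partial_d_def tensor_map_def)
qed

definition grad_sq :: "nat \<Rightarrow> complex mat \<Rightarrow> complex mat" where
  "grad_sq n T =
     (\<Oplus>\<^bsub>module_mat TYPE(complex) (2 ^ n) (2 ^ n)\<^esub>j\<in>{1..n}. mat_adjoint (partial_d n j T) * partial_d n j T)"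

end

theory Submission
  imports Defs "Jordan_Normal_Form.Spectral_Radius"
begin

text \<open>
  The inequality is proved by comparing two estimates on the stability \<open>f u = tr (T Q\<^sub>u T)\<close> of the
  projection \<open>T\<close> under noise. Here \<open>Q\<^sub>u\<close> is the depolarizing semigroup with multiplicative parameter:
  with \<open>E\<^sub>j\<close> the partial trace over the \<open>j\<close>-th qubit and \<open>d\<^sub>j = id - E\<^sub>j\<close>, it is the product over
  \<open>j\<close> of the one-qubit channels \<open>R\<^sub>j = E\<^sub>j + u d\<^sub>j\<close>. Write \<open>\<tau> = tr T\<close>, so that \<open>f 1 = \<tau>\<close> and
  \<open>var T = \<tau> (1 - \<tau>)\<close>, and let \<open>G\<close> be the \<open>L\<^sub>1\<close>-norm of the gradient.

  \<^bold>\<open>A small gradient keeps \<open>f u\<close> close to \<open>\<tau>\<close>.\<close> The Schwarz defect of \<open>R\<^sub>j\<close> can be computed, and it satisfies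
  \<open>R\<^sub>j (y\<^sup>* y) - (R\<^sub>j y)\<^sup>* (R\<^sub>j y) \<ge> u (1 - u) \<bar>d\<^sub>j y\<bar>\<^sup>2\<close>. Telescoping over the qubits gives
  \<open>u (1 - u) \<Sum>\<^sub>j \<bar>d\<^sub>j Q\<^sub>u' T\<bar>\<^sup>2 \<le> 1\<close>, where \<open>Q\<^sub>u'\<close> omits the \<open>j\<close>-th factor
  (\<open>gradient_estimate\<close>). On the other hand \<open>f' u = \<Sum>\<^sub>j tr ((d\<^sub>j T)\<^sup>* d\<^sub>j Q\<^sub>u' T)\<close>, and the
  duality between columns in \<open>L\<^sub>1\<close> and \<open>L\<^sub>\<infinity>\<close> (\<open>column_duality\<close>) bounds this by
  \<open>G / sqrt (u (1 - u))\<close>. Integrating, \<open>\<tau> - f u \<le> 4 G sqrt (1 - u)\<close> for \<open>u \<ge> 1/4\<close>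
  (\<open>stability_increment_le\<close>).

  \<^bold>\<open>Small projections are destroyed by little noise.\<close> The map \<open>Q\<^sub>u\<close> with \<open>u = 1/4\<close> is a contraction
  from \<open>L\<^sub>2\<close> to \<open>L\<^sub>4\<close> (\<open>hypercontractivity\<close>), hence \<open>f (1/4) \<le> \<tau> \<tau>\<^sup>1\<^sup>/\<^sup>4\<close>. Since
  \<open>f\<close> is log-convex in \<open>log u\<close>, taking square roots of \<open>u\<close> repeatedly yields
  \<open>f (4 powr - h) \<le> \<tau> \<tau> powr (h / 4)\<close> for \<open>h = 2 powr - m\<close> (\<open>small_set_expansion\<close>).

  With \<open>h\<close> of the order of \<open>1 / ln (1 / \<tau>)\<close> the second estimate says that \<open>\<tau> - f u\<close> is at least a
  fixed fraction of \<open>\<tau>\<close>, while the first bounds it by a multiple of \<open>G / sqrt (ln (1 / \<tau>))\<close>. This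
  is the claim for \<open>\<tau> \<le> 1/2\<close>, and passing to \<open>1 - T\<close> gives the rest
  (\<open>projection_isoperimetry\<close>, with constant 72).

  The matrix algebra enters through its positive trace and, for each qubit, the two commuting automorphisms
  given by conjugation with the Pauli matrices \<open>X\<close> and \<open>Z\<close>; the partial trace averages over the
  group of order four that they generate. The argument is therefore carried out in a
  locale for real algebras with this structure. The locale is interpreted in the algebra of finitely
  supported infinite matrices, which is one type containing all \<open>2\<^sup>n \<times> 2\<^sup>n\<close> matrices as
  upper left corners.
\<close>

section \<open>Tracial star-algebras\<close>

text \<open>The trace stands for the real part of a complex trace, which makes \<open>tr (x\<^sup>\<dagger> * y)\<close> a real
  semi-inner product.\<close>

locale tracial_star_algebra =
  fixes star :: "'a::real_algebra \<Rightarrow> 'a" (\<open>_\<^sup>\<dagger>\<close> [1000] 999)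
    and tr :: "'a \<Rightarrow> real"
  assumes star_add [simp]: "(x + y)\<^sup>\<dagger> = x\<^sup>\<dagger> + y\<^sup>\<dagger>"
    and star_scaleR [simp]: "(c *\<^sub>R x)\<^sup>\<dagger> = c *\<^sub>R x\<^sup>\<dagger>"
    and star_mult [simp]: "(x * y)\<^sup>\<dagger> = y\<^sup>\<dagger> * x\<^sup>\<dagger>"
    and star_star [simp]: "(x\<^sup>\<dagger>)\<^sup>\<dagger> = x"
    and tr_add [simp]: "tr (x + y) = tr x + tr y"
    and tr_scaleR [simp]: "tr (c *\<^sub>R x) = c * tr x"
    and tr_commute: "tr (x * y) = tr (y * x)"
    and tr_star [simp]: "tr (x\<^sup>\<dagger>) = tr x"
    and tr_square_nonneg [simp]: "0 \<le> tr (x\<^sup>\<dagger> * x)"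
begin

lemma star_zero [simp]: "0\<^sup>\<dagger> = 0"
  using star_scaleR[of 0 0] by simp

lemma star_minus [simp]: "(- x)\<^sup>\<dagger> = - x\<^sup>\<dagger>"
  using star_scaleR[of "-1" x] by simp

lemma star_diff [simp]: "(x - y)\<^sup>\<dagger> = x\<^sup>\<dagger> - y\<^sup>\<dagger>"
  using star_add[of x "- y"] by simp

lemma tr_zero [simp]: "tr 0 = 0"
  using tr_scaleR[of 0 0] by simp

lemma tr_minus [simp]: "tr (- x) = - tr x"
  using tr_scaleR[of "-1" x] by simp

lemma tr_diff [simp]: "tr (x - y) = tr x - tr y"
  using tr_add[of x "- y"] by simp

lemma tr_sum: "tr (\<Sum>i\<in>I. f i) = (\<Sum>i\<in>I. tr (f i))"
  by (induction I rule: infinite_finite_induct) auto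

lemma star_sum: "(\<Sum>i\<in>I. f i)\<^sup>\<dagger> = (\<Sum>i\<in>I. (f i)\<^sup>\<dagger>)"
  by (induction I rule: infinite_finite_induct) auto

lemma tr_star_mult_sym: "tr (x\<^sup>\<dagger> * y) = tr (y\<^sup>\<dagger> * x)"
  using tr_star[of "x\<^sup>\<dagger> * y"] by simp

text \<open>This is the Cauchy--Schwarz inequality for the semi-inner product on families indexed by \<open>J\<close>,
  obtained from the nonnegative quadratic polynomial \<open>t \<mapsto> \<parallel>x + t y\<parallel>\<^sup>2\<close>. Its leading
  coefficient may vanish, since the trace is not assumed to be faithful.\<close>

lemma tr_Cauchy_Schwarz_sum:
  "(\<Sum>j\<in>J. tr ((x j)\<^sup>\<dagger> * y j))\<^sup>2 \<le> (\<Sum>j\<in>J. tr ((x j)\<^sup>\<dagger> * x j)) * (\<Sum>j\<in>J. tr ((y j)\<^sup>\<dagger> * y j))"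
  (is "?b\<^sup>2 \<le> ?a * ?c")
proof -
  have quad: "0 \<le> ?a + 2 * t * ?b + t\<^sup>2 * ?c" for t
  proof -
    have "0 \<le> (\<Sum>j\<in>J. tr ((x j + t *\<^sub>R y j)\<^sup>\<dagger> * (x j + t *\<^sub>R y j)))"
      by (intro sum_nonneg tr_square_nonneg)
    also have "\<dots> = (\<Sum>j\<in>J. tr ((x j)\<^sup>\<dagger> * x j) + 2 * t * tr ((x j)\<^sup>\<dagger> * y j) + t\<^sup>2 * tr ((y j)\<^sup>\<dagger> * y j))"
      by (rule sum.cong) (auto simp: algebra_simps power2_eq_square tr_star_mult_sym[of "y _" "x _"])
    finally show ?thesis by (simp add: sum.distrib sum_distrib_left)
  qed
  have c: "0 \<le> ?c" by (intro sum_nonneg tr_square_nonneg)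
  show ?thesis
  proof (cases "?c = 0")
    case True
    have "?b = 0"
    proof (rule ccontr)
      assume "?b \<noteq> 0"
      then have "?a + 2 * (- (?a + 1) / (2 * ?b)) * ?b = - 1" by (simp add: field_simps)
      with quad[of "- (?a + 1) / (2 * ?b)"] show False by (simp add: True)
    qed
    then show ?thesis by (simp add: True)
  next
    case False
    then show ?thesis using quad[of "- ?b / ?c"] c
      by (simp add: field_simps power2_eq_square split: if_splits)
  qed
qed

text \<open>The Schatten norms of order 2 and 4. The latter satisfies \<open>nrm4 x ^ 4 = tr ((x\<^sup>\<dagger> * x) * (x\<^sup>\<dagger> * x))\<close>,
  so that it can be handled with the Cauchy--Schwarz inequality alone.\<close>

definition nrm2 :: "'a \<Rightarrow> real" where "nrm2 x = sqrt (tr (x\<^sup>\<dagger> * x))"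
definition nrm4 :: "'a \<Rightarrow> real" where "nrm4 x = sqrt (nrm2 (x\<^sup>\<dagger> * x))"

lemma nrm2_nonneg [simp]: "0 \<le> nrm2 x" by (simp add: nrm2_def)
lemma nrm4_nonneg [simp]: "0 \<le> nrm4 x" by (simp add: nrm4_def)
lemma nrm2_sq: "(nrm2 x)\<^sup>2 = tr (x\<^sup>\<dagger> * x)" by (simp add: nrm2_def)
lemma nrm4_sq: "(nrm4 x)\<^sup>2 = nrm2 (x\<^sup>\<dagger> * x)" by (simp add: nrm4_def)

lemma nrm2_scaleR: "0 \<le> c \<Longrightarrow> nrm2 (c *\<^sub>R x) = c * nrm2 x"
  by (simp add: nrm2_def real_sqrt_mult)

lemma nrm4_scaleR: "0 \<le> c \<Longrightarrow> nrm4 (c *\<^sub>R x) = c * nrm4 x"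
  by (simp add: nrm4_def nrm2_scaleR real_sqrt_mult)

lemma Cauchy_Schwarz: "tr (x\<^sup>\<dagger> * y) \<le> nrm2 x * nrm2 y"
proof -
  have "(tr (x\<^sup>\<dagger> * y))\<^sup>2 \<le> (nrm2 x * nrm2 y)\<^sup>2"
    using tr_Cauchy_Schwarz_sum[of "\<lambda>_. x" "\<lambda>_. y" "{()}"] by (simp add: power_mult_distrib nrm2_sq)
  then show ?thesis by (rule power2_le_imp_le) simp
qed

lemma nrm2_add_sq: "(nrm2 (x + y))\<^sup>2 = (nrm2 x)\<^sup>2 + 2 * tr (x\<^sup>\<dagger> * y) + (nrm2 y)\<^sup>2"
  by (simp add: nrm2_sq algebra_simps tr_star_mult_sym[of y x])

lemma nrm2_triangle: "nrm2 (x + y) \<le> nrm2 x + nrm2 y"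
proof (rule power2_le_imp_le)
  show "(nrm2 (x + y))\<^sup>2 \<le> (nrm2 x + nrm2 y)\<^sup>2"
    using Cauchy_Schwarz[of x y] by (simp add: nrm2_add_sq power2_sum)
qed simp

lemma nrm2_self_mult_star: "nrm2 (x * x\<^sup>\<dagger>) = nrm2 (x\<^sup>\<dagger> * x)"
  by (simp add: nrm2_def mult.assoc) (metis mult.assoc tr_commute)

lemma nrm4_star [simp]: "nrm4 (x\<^sup>\<dagger>) = nrm4 x"
  by (simp add: nrm4_def nrm2_self_mult_star)

text \<open>Cyclicity of the trace turns \<open>tr ((x y)\<^sup>\<dagger> x y)\<close> into the inner product of \<open>x\<^sup>\<dagger> x\<close> and \<open>y y\<^sup>\<dagger>\<close>. It is the
  Hoelder inequality with exponents \<open>1/2 = 1/4 + 1/4\<close>.\<close>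

lemma nrm2_mult_le: "nrm2 (x * y) \<le> nrm4 x * nrm4 y"
proof (rule power2_le_imp_le)
  have "(nrm2 (x * y))\<^sup>2 = tr ((x\<^sup>\<dagger> * x)\<^sup>\<dagger> * (y * y\<^sup>\<dagger>))"
    by (simp add: nrm2_sq mult.assoc) (metis mult.assoc tr_commute)
  also have "\<dots> \<le> nrm2 (x\<^sup>\<dagger> * x) * nrm2 (y * y\<^sup>\<dagger>)" by (rule Cauchy_Schwarz)
  also have "\<dots> = (nrm4 x * nrm4 y)\<^sup>2"
    by (simp add: power_mult_distrib nrm4_sq nrm2_self_mult_star)
  finally show "(nrm2 (x * y))\<^sup>2 \<le> (nrm4 x * nrm4 y)\<^sup>2" .
qed simp

lemma nrm4_triangle: "nrm4 (x + y) \<le> nrm4 x + nrm4 y"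
proof (rule power2_le_imp_le)
  have "(nrm4 (x + y))\<^sup>2 = nrm2 ((x\<^sup>\<dagger> * x + x\<^sup>\<dagger> * y) + (y\<^sup>\<dagger> * x + y\<^sup>\<dagger> * y))"
    by (simp add: nrm4_sq algebra_simps)
  also have "\<dots> \<le> (nrm2 (x\<^sup>\<dagger> * x) + nrm2 (x\<^sup>\<dagger> * y)) + (nrm2 (y\<^sup>\<dagger> * x) + nrm2 (y\<^sup>\<dagger> * y))"
    by (intro order.trans[OF nrm2_triangle] add_mono nrm2_triangle)
  also have "\<dots> \<le> (nrm4 x * nrm4 x + nrm4 x * nrm4 y) + (nrm4 y * nrm4 x + nrm4 y * nrm4 y)"
    using nrm2_mult_le[of "x\<^sup>\<dagger>"] nrm2_mult_le[of "y\<^sup>\<dagger>"] by (intro add_mono) auto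
  also have "\<dots> = (nrm4 x + nrm4 y)\<^sup>2" by (simp add: power2_eq_square algebra_simps)
  finally show "(nrm4 (x + y))\<^sup>2 \<le> (nrm4 x + nrm4 y)\<^sup>2" .
qed simp

text \<open>The Hoelder inequality between \<open>T\<close> in \<open>L\<^sub>4\<^sub>/\<^sub>3\<close> and \<open>g\<close> in \<open>L\<^sub>4\<close>, in squared form: for a projection the
  \<open>4/3\<close>-norm is \<open>(tr T) powr (3/4)\<close>, and \<open>tr T * nrm2 T\<close> is its square. Two applications of
  Cauchy--Schwarz suffice because \<open>T\<close> is idempotent.\<close>

lemma tr_projection_le:
  assumes T: "T\<^sup>\<dagger> = T" "T * T = T"
  shows "(tr (T * g))\<^sup>2 \<le> tr T * (nrm2 T * (nrm4 g)\<^sup>2)"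
proof -
  have n2: "(nrm2 T)\<^sup>2 = tr T" by (simp add: nrm2_sq T)
  have "tr (T * g) \<le> nrm2 T * nrm2 (T * g)" "tr (T * (- g)) \<le> nrm2 T * nrm2 (T * g)"
    using Cauchy_Schwarz[of T "T * g"] Cauchy_Schwarz[of T "T * (- g)"]
    by (simp_all add: T mult.assoc[symmetric] nrm2_def)
  then have "\<bar>tr (T * g)\<bar> \<le> nrm2 T * nrm2 (T * g)" by (simp add: abs_le_iff)
  then have "(tr (T * g))\<^sup>2 \<le> (nrm2 T * nrm2 (T * g))\<^sup>2"
    by (metis abs_ge_zero power2_abs power_mono)
  also have "\<dots> = tr T * (nrm2 (T * g))\<^sup>2" by (simp add: power_mult_distrib n2)
  also have "(nrm2 (T * g))\<^sup>2 = tr (g\<^sup>\<dagger> * (T * T) * g)" by (simp add: nrm2_sq T(1) mult.assoc)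
  also have "\<dots> = tr (T\<^sup>\<dagger> * (g * g\<^sup>\<dagger>))" unfolding T by (metis mult.assoc tr_commute)
  also have "tr T * \<dots> \<le> tr T * (nrm2 T * nrm2 (g * g\<^sup>\<dagger>))"
    using n2 zero_le_power2[of "nrm2 T"] by (intro mult_left_mono Cauchy_Schwarz) simp
  finally show ?thesis by (simp add: nrm4_sq nrm2_self_mult_star)
qed

text \<open>Positivity is tested weakly, against all \<open>y\<close>, so that closure of the cone under sums and
  trace-preserving automorphisms is immediate.\<close>

definition pos :: "'a \<Rightarrow> bool" where
  "pos x \<longleftrightarrow> (\<forall>y. 0 \<le> tr (y\<^sup>\<dagger> * x * y))"

lemma pos_add: "pos x \<Longrightarrow> pos y \<Longrightarrow> pos (x + y)"
  by (auto simp: pos_def algebra_simps)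

lemma pos_scaleR: "0 \<le> c \<Longrightarrow> pos x \<Longrightarrow> pos (c *\<^sub>R x)"
  by (auto simp: pos_def)

lemma pos_zero [simp]: "pos 0" by (simp add: pos_def)

lemma pos_square [simp]: "pos (x\<^sup>\<dagger> * x)"
  unfolding pos_def
proof
  fix y show "0 \<le> tr (y\<^sup>\<dagger> * (x\<^sup>\<dagger> * x) * y)"
    using tr_square_nonneg[of "x * y"] by (simp add: mult.assoc)
qed

lemma pos_sum: "(\<And>i. i \<in> I \<Longrightarrow> pos (f i)) \<Longrightarrow> pos (\<Sum>i\<in>I. f i)"
  by (induction I rule: infinite_finite_induct) (auto intro: pos_add)

text \<open>The duality between columns in \<open>L\<^sub>1\<close> and in \<open>L\<^sub>\<infinity>\<close>: the \<open>p i\<close> are spectral projections of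
  \<open>\<Sum>\<^sub>j \<bar>a j\<bar>\<^sup>2\<close> with eigenvalues \<open>(s i)\<^sup>2\<close>, so that the last sum is the trace of the square root
  of that element. Cutting the column \<open>a\<close> with \<open>p i\<close> makes its square function constant, and there
  Cauchy--Schwarz loses nothing.\<close>

lemma column_duality:
  assumes I: "finite I"
    and p: "\<And>i. i \<in> I \<Longrightarrow> (p i)\<^sup>\<dagger> = p i" "\<And>i. i \<in> I \<Longrightarrow> p i * p i = p i"
    and e: "(\<Sum>i\<in>I. p i) = e" "\<And>i. i \<in> I \<Longrightarrow> e * p i = p i"
    and a: "\<And>j. j \<in> J \<Longrightarrow> a j * e = a j"
    and s: "\<And>i. i \<in> I \<Longrightarrow> 0 \<le> s i"
      "\<And>i. i \<in> I \<Longrightarrow> tr (p i * (\<Sum>j\<in>J. (a j)\<^sup>\<dagger> * a j) * p i) = (s i)\<^sup>2 * tr (p i)"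
    and b: "pos (C *\<^sub>R e - (\<Sum>j\<in>J. (b j)\<^sup>\<dagger> * b j))" and C: "0 \<le> C"
  shows "(\<Sum>j\<in>J. tr ((a j)\<^sup>\<dagger> * b j)) \<le> sqrt C * (\<Sum>i\<in>I. s i * tr (p i))"
proof -
  have trp: "0 \<le> tr (p i)" if "i \<in> I" for i
    using tr_square_nonneg[of "p i"] by (simp add: p that)
  have cut: "tr ((a j)\<^sup>\<dagger> * b j) = (\<Sum>i\<in>I. tr ((a j * p i)\<^sup>\<dagger> * (b j * p i)))" if j: "j \<in> J" for j
  proof -
    have "(\<Sum>i\<in>I. tr ((a j * p i)\<^sup>\<dagger> * (b j * p i))) = (\<Sum>i\<in>I. tr (p i * ((a j)\<^sup>\<dagger> * b j)))"
    proof (rule sum.cong)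
      fix i assume i: "i \<in> I"
      have "tr ((a j * p i)\<^sup>\<dagger> * (b j * p i)) = tr (p i * ((a j)\<^sup>\<dagger> * b j * p i))"
        using p(1)[OF i] by (simp add: mult.assoc)
      also have "\<dots> = tr ((a j)\<^sup>\<dagger> * b j * (p i * p i))" by (subst tr_commute) (simp add: mult.assoc)
      finally show "tr ((a j * p i)\<^sup>\<dagger> * (b j * p i)) = tr (p i * ((a j)\<^sup>\<dagger> * b j))"
        using p(2)[OF i] by (metis tr_commute)
    qed simp
    also have "\<dots> = tr (e * ((a j)\<^sup>\<dagger> * b j))"
      by (simp add: e(1)[symmetric] sum_distrib_right tr_sum)
    also have "\<dots> = tr ((a j * e\<^sup>\<dagger>)\<^sup>\<dagger> * b j)" by (simp add: mult.assoc)
    also have "e\<^sup>\<dagger> = e" unfolding e(1)[symmetric] star_sum using p(1) by (intro sum.cong) auto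
    finally show ?thesis using a[OF j] by simp
  qed
  have col: "(\<Sum>j\<in>J. tr ((a j * p i)\<^sup>\<dagger> * (b j * p i))) \<le> sqrt C * (s i * tr (p i))"
    if i: "i \<in> I" for i
  proof (rule power2_le_imp_le)
    have A: "(\<Sum>j\<in>J. tr ((a j * p i)\<^sup>\<dagger> * (a j * p i))) = (s i)\<^sup>2 * tr (p i)"
      using s(2)[OF i] p(1)[OF i] by (simp add: sum_distrib_left sum_distrib_right tr_sum mult.assoc)
    have "0 \<le> tr ((p i)\<^sup>\<dagger> * (C *\<^sub>R e - (\<Sum>j\<in>J. (b j)\<^sup>\<dagger> * b j)) * p i)"
      using b unfolding pos_def by blast
    then have B: "(\<Sum>j\<in>J. tr ((b j * p i)\<^sup>\<dagger> * (b j * p i))) \<le> C * tr (p i)"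
      using p[OF i] e(2)[OF i]
      by (simp add: algebra_simps sum_distrib_left sum_distrib_right tr_sum mult.assoc)
    have "(\<Sum>j\<in>J. tr ((a j * p i)\<^sup>\<dagger> * (b j * p i)))\<^sup>2 \<le> ((s i)\<^sup>2 * tr (p i)) * (C * tr (p i))"
      by (rule order.trans[OF tr_Cauchy_Schwarz_sum])
        (use A B trp[OF i] in \<open>auto intro!: mult_left_mono\<close>)
    also have "\<dots> = (sqrt C * (s i * tr (p i)))\<^sup>2"
      using C by (simp add: power_mult_distrib power2_eq_square)
    finally show "(\<Sum>j\<in>J. tr ((a j * p i)\<^sup>\<dagger> * (b j * p i)))\<^sup>2 \<le> (sqrt C * (s i * tr (p i)))\<^sup>2" .
  qed (use trp[OF i] s(1)[OF i] C in auto)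
  have "(\<Sum>j\<in>J. tr ((a j)\<^sup>\<dagger> * b j)) = (\<Sum>i\<in>I. \<Sum>j\<in>J. tr ((a j * p i)\<^sup>\<dagger> * (b j * p i)))"
    by (simp only: cut cong: sum.cong) (rule sum.swap)
  also have "\<dots> \<le> (\<Sum>i\<in>I. sqrt C * (s i * tr (p i)))" by (intro sum_mono col)
  finally show ?thesis by (simp add: sum_distrib_left)
qed

definition involutive_aut :: "('a \<Rightarrow> 'a) \<Rightarrow> bool" where
  "involutive_aut \<theta> \<longleftrightarrow> (\<forall>x y. \<theta> (x + y) = \<theta> x + \<theta> y) \<and> (\<forall>c x. \<theta> (c *\<^sub>R x) = c *\<^sub>R \<theta> x) \<and>
     (\<forall>x y. \<theta> (x * y) = \<theta> x * \<theta> y) \<and> (\<forall>x. \<theta> (x\<^sup>\<dagger>) = (\<theta> x)\<^sup>\<dagger>) \<and> (\<forall>x. tr (\<theta> x) = tr x) \<and>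
     (\<forall>x. \<theta> (\<theta> x) = x)"

lemma pos_aut:
  assumes "involutive_aut \<theta>" "pos x"
  shows "pos (\<theta> x)"
  unfolding pos_def
proof
  fix y
  have "tr (y\<^sup>\<dagger> * \<theta> x * y) = tr (\<theta> (y\<^sup>\<dagger> * \<theta> x * y))"
    using assms(1) unfolding involutive_aut_def by metis
  also have "\<theta> (y\<^sup>\<dagger> * \<theta> x * y) = (\<theta> y)\<^sup>\<dagger> * x * \<theta> y"
    using assms(1) unfolding involutive_aut_def by metis
  also have "0 \<le> tr \<dots>" using assms(2) unfolding pos_def by blast
  finally show "0 \<le> tr (y\<^sup>\<dagger> * \<theta> x * y)" .
qed

end

section \<open>Commuting automorphisms and the depolarizing semigroup\<close>

text \<open>The automorphisms \<open>\<alpha> j\<close> and \<open>\<beta> j\<close> model conjugation by the Pauli matrices \<open>X\<close> and \<open>Z\<close> at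
  site \<open>j\<close>, and \<open>e\<close> is the unit of the algebra of the first \<open>n\<close> qubits, which may be a corner of a
  larger algebra. The last assumption says that only scalars commute with all Pauli matrices.\<close>

locale qubit_system = tracial_star_algebra star tr
  for star :: "'a::real_algebra \<Rightarrow> 'a" (\<open>_\<^sup>\<dagger>\<close> [1000] 999) and tr :: "'a \<Rightarrow> real" +
  fixes e :: 'a and n :: nat and \<alpha> \<beta> :: "nat \<Rightarrow> 'a \<Rightarrow> 'a"
  assumes e [simp]: "e\<^sup>\<dagger> = e" "e * e = e" "tr e = 1"
    and aut: "involutive_aut (\<alpha> j)" "involutive_aut (\<beta> j)"
    and \<alpha>\<alpha>: "\<alpha> i (\<alpha> j x) = \<alpha> j (\<alpha> i x)"
    and \<beta>\<beta>: "\<beta> i (\<beta> j x) = \<beta> j (\<beta> i x)"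
    and \<alpha>\<beta>: "\<alpha> i (\<beta> j x) = \<beta> j (\<alpha> i x)"
    and fix_e: "j < n \<Longrightarrow> \<alpha> j e = e" "j < n \<Longrightarrow> \<beta> j e = e"
    and ergodic: "\<lbrakk>h\<^sup>\<dagger> = h; h * e = h; \<And>j. j < n \<Longrightarrow> \<alpha> j h = h; \<And>j. j < n \<Longrightarrow> \<beta> j h = h\<rbrakk>
      \<Longrightarrow> \<exists>c. h = c *\<^sub>R e"
begin

lemma aut_simps [simp]:
  "\<alpha> j (x + y) = \<alpha> j x + \<alpha> j y" "\<beta> j (x + y) = \<beta> j x + \<beta> j y"
  "\<alpha> j (c *\<^sub>R x) = c *\<^sub>R \<alpha> j x" "\<beta> j (c *\<^sub>R x) = c *\<^sub>R \<beta> j x"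
  "\<alpha> j (x * y) = \<alpha> j x * \<alpha> j y" "\<beta> j (x * y) = \<beta> j x * \<beta> j y"
  "\<alpha> j (x\<^sup>\<dagger>) = (\<alpha> j x)\<^sup>\<dagger>" "\<beta> j (x\<^sup>\<dagger>) = (\<beta> j x)\<^sup>\<dagger>"
  "tr (\<alpha> j x) = tr x" "tr (\<beta> j x) = tr x"
  "\<alpha> j (\<alpha> j x) = x" "\<beta> j (\<beta> j x) = x"
  using aut[of j] unfolding involutive_aut_def by auto

text \<open>For signs \<open>s\<close> and \<open>t\<close> this is the projection onto the joint eigenspace of \<open>\<alpha> j\<close> and \<open>\<beta> j\<close> with
  eigenvalues \<open>s\<close> and \<open>t\<close>. The four sign parts of \<open>x\<close> are the terms of its expansion in the Pauli
  matrices at site \<open>j\<close>; the one with both signs positive is the partial trace \<open>E j\<close>.\<close>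

definition sign_part :: "real \<Rightarrow> real \<Rightarrow> nat \<Rightarrow> 'a \<Rightarrow> 'a" where
  "sign_part s t j x = (1/4) *\<^sub>R (x + s *\<^sub>R \<alpha> j x + t *\<^sub>R \<beta> j x + (s * t) *\<^sub>R \<alpha> j (\<beta> j x))"

definition E :: "nat \<Rightarrow> 'a \<Rightarrow> 'a" where "E = sign_part 1 1"

definition d :: "nat \<Rightarrow> 'a \<Rightarrow> 'a" where "d j x = x - E j x"

definition R :: "real \<Rightarrow> nat \<Rightarrow> 'a \<Rightarrow> 'a" where "R u j x = (1 - u) *\<^sub>R E j x + u *\<^sub>R x"

text \<open>A list of sites rather than a set: the order is immaterial since the factors commute, but recursion on the
  list makes every statement about the semigroup an induction over one site at a time.\<close>

fun Q :: "real \<Rightarrow> nat list \<Rightarrow> 'a \<Rightarrow> 'a" where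
  "Q u [] x = x"
| "Q u (j # js) x = R u j (Q u js x)"

text \<open>Every operator used below is a linear combination of products of the \<open>\<alpha> j\<close> and \<open>\<beta> j\<close>. Equivariance
  captures this well enough to conclude that all these operators commute.\<close>

definition equivariant :: "('a \<Rightarrow> 'a) \<Rightarrow> bool" where
  "equivariant \<theta> \<longleftrightarrow> (\<forall>x y. \<theta> (x + y) = \<theta> x + \<theta> y) \<and> (\<forall>c x. \<theta> (c *\<^sub>R x) = c *\<^sub>R \<theta> x) \<and>
     (\<forall>j x. \<theta> (\<alpha> j x) = \<alpha> j (\<theta> x)) \<and> (\<forall>j x. \<theta> (\<beta> j x) = \<beta> j (\<theta> x))"

lemma equivariant_\<alpha>: "equivariant (\<alpha> i)"
  unfolding equivariant_def using \<alpha>\<alpha> \<alpha>\<beta> by auto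

lemma equivariant_\<beta>: "equivariant (\<beta> i)"
  unfolding equivariant_def using \<beta>\<beta> \<alpha>\<beta> by auto

lemma equivariant_sign_part_commute: "equivariant \<theta> \<Longrightarrow> \<theta> (sign_part s t j x) = sign_part s t j (\<theta> x)"
  by (simp add: equivariant_def sign_part_def)

lemma sign_part_linear [simp]:
  "sign_part s t j (x + y) = sign_part s t j x + sign_part s t j y" "sign_part s t j (c *\<^sub>R x) = c *\<^sub>R sign_part s t j x"
  by (simp_all add: sign_part_def algebra_simps)

lemma equivariant_sign_part: "equivariant (sign_part s t i)"
  unfolding equivariant_def
  using equivariant_sign_part_commute[OF equivariant_\<alpha>] equivariant_sign_part_commute[OF equivariant_\<beta>] by simp

lemma equivariant_R_commute: "equivariant \<theta> \<Longrightarrow> \<theta> (R u j x) = R u j (\<theta> x)"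
  using equivariant_sign_part_commute[of \<theta> 1 1] by (simp add: equivariant_def R_def E_def)

lemma equivariant_Q_commute: "equivariant \<theta> \<Longrightarrow> \<theta> (Q u js x) = Q u js (\<theta> x)"
  by (induction js) (simp_all add: equivariant_R_commute)

lemma R_linear [simp]:
  "R u j (x + y) = R u j x + R u j y" "R u j (c *\<^sub>R x) = c *\<^sub>R R u j x"
  by (simp_all add: R_def E_def algebra_simps)

lemma equivariant_R: "equivariant (R u i)"
  unfolding equivariant_def
  using equivariant_R_commute[OF equivariant_\<alpha>] equivariant_R_commute[OF equivariant_\<beta>] by simp

lemma R_zero [simp]: "R u j 0 = 0"
  using R_linear(2)[of u j 0 0] by simp

lemma R_diff [simp]: "R u j (x - y) = R u j x - R u j y"
  using R_linear(1)[of u j x "(- 1) *\<^sub>R y"] by (simp only: R_linear(2)) simp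

lemma R_sum: "R u j (\<Sum>i\<in>I. f i) = (\<Sum>i\<in>I. R u j (f i))"
  by (induction I rule: infinite_finite_induct) auto

lemma E_linear [simp]:
  "E j (x + y) = E j x + E j y" "E j (c *\<^sub>R x) = c *\<^sub>R E j x"
  by (simp_all add: E_def)

lemma E_diff [simp]: "E j (x - y) = E j x - E j y"
  using E_linear(1)[of j x "(- 1) *\<^sub>R y"] by (simp only: E_linear(2)) simp

lemma d_R_commute: "d i (R u j x) = R u j (d i x)"
  using equivariant_R_commute[OF equivariant_sign_part, of 1 1 i u j x] by (simp add: d_def E_def)

lemma Q_linear [simp]:
  "Q u js (x + y) = Q u js x + Q u js y" "Q u js (c *\<^sub>R x) = c *\<^sub>R Q u js x"
  by (induction js) simp_all

lemma Q_diff [simp]: "Q u js (x - y) = Q u js x - Q u js y"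
  by (induction js) simp_all

lemma sign_part_eigen:
  assumes "s\<^sup>2 = 1" "t\<^sup>2 = 1"
  shows "\<alpha> j (sign_part s t j x) = s *\<^sub>R sign_part s t j x" "\<beta> j (sign_part s t j x) = t *\<^sub>R sign_part s t j x"
  using assms \<alpha>\<beta>[of j j x]
  by (auto simp: sign_part_def algebra_simps power2_eq_square \<alpha>\<beta> simp flip: mult.assoc)

lemma sign_part_of_eigen:
  assumes "\<alpha> j x = s *\<^sub>R x" "\<beta> j x = t *\<^sub>R x"
  shows "sign_part s' t' j x = ((1 + s * s') * (1 + t * t') / 4) *\<^sub>R x"
  unfolding sign_part_def by (simp add: assms algebra_simps scaleR_left_distrib add_divide_distrib)

lemma sign_part_idem [simp]: "s\<^sup>2 = 1 \<Longrightarrow> t\<^sup>2 = 1 \<Longrightarrow> sign_part s t j (sign_part s t j x) = sign_part s t j x"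
  using sign_part_of_eigen[OF sign_part_eigen, of s t s t j x] by (simp add: power2_eq_square)

lemma sign_part_decomposition: "E j x + sign_part 1 (-1) j x + sign_part (-1) 1 j x + sign_part (-1) (-1) j x = x"
proof -
  have "E j x + sign_part 1 (-1) j x + sign_part (-1) 1 j x + sign_part (-1) (-1) j x = (1/4) *\<^sub>R x + (1/4) *\<^sub>R x + (1/4) *\<^sub>R x + (1/4) *\<^sub>R x"
    by (simp add: E_def sign_part_def algebra_simps)
  also have "\<dots> = x" by (simp flip: scaleR_left_distrib)
  finally show ?thesis .
qed

lemma E_fixed [simp]: "\<alpha> j (E j x) = E j x" "\<beta> j (E j x) = E j x"
  using sign_part_eigen[of 1 1 j x] by (simp_all add: E_def)

lemma E_E [simp]: "E j (E j x) = E j x" by (simp add: E_def)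

lemma E_star [simp]: "E j (x\<^sup>\<dagger>) = (E j x)\<^sup>\<dagger>" by (simp add: E_def sign_part_def)

lemma E_d [simp]: "E j (d j x) = 0" by (simp add: d_def)

lemma d_d [simp]: "d j (d j x) = d j x" by (simp add: d_def)

lemma d_star [simp]: "d j (x\<^sup>\<dagger>) = (d j x)\<^sup>\<dagger>" by (simp add: d_def)

lemma R_star [simp]: "R u j (x\<^sup>\<dagger>) = (R u j x)\<^sup>\<dagger>" by (simp add: R_def)

lemma Q_star [simp]: "Q u js (x\<^sup>\<dagger>) = (Q u js x)\<^sup>\<dagger>" by (induction js) simp_all

text \<open>The automorphisms fix the range of \<open>E j\<close>, so averaging over them is linear over that range. This is what
  makes \<open>E j\<close> a conditional expectation.\<close>

lemma E_bimodule: "E j (E j x * y) = E j x * E j y" "E j (x * E j y) = E j x * E j y"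
proof -
  show "E j (E j x * y) = E j x * E j y"
    unfolding E_def[THEN fun_cong, THEN fun_cong, of j "E j x * y"] E_def[THEN fun_cong, THEN fun_cong, of j y]
    by (simp add: sign_part_def[of _ _ _ y] sign_part_def[of _ _ _ "_ * _"] algebra_simps)
  show "E j (x * E j y) = E j x * E j y"
    unfolding E_def[THEN fun_cong, THEN fun_cong, of j "x * E j y"] E_def[THEN fun_cong, THEN fun_cong, of j x]
    by (simp add: sign_part_def[of _ _ _ x] sign_part_def[of _ _ _ "_ * _"] algebra_simps)
qed

lemma tr_\<alpha>_left: "tr (\<alpha> j x * y) = tr (x * \<alpha> j y)"
  using aut_simps(9)[of j "x * \<alpha> j y"] by simp

lemma tr_\<beta>_left: "tr (\<beta> j x * y) = tr (x * \<beta> j y)"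
  using aut_simps(10)[of j "x * \<beta> j y"] by simp

lemma tr_sign_part_left: "tr (sign_part s t j x * y) = tr (x * sign_part s t j y)"
  by (simp add: sign_part_def algebra_simps tr_\<alpha>_left tr_\<beta>_left \<alpha>\<beta>)

lemma tr_E_left: "tr (E j x * y) = tr (x * E j y)"
  by (simp add: E_def tr_sign_part_left)

lemma tr_d_left: "tr (d j x * y) = tr (x * d j y)"
  by (simp add: d_def algebra_simps tr_E_left)

lemma tr_R_left: "tr (R u j x * y) = tr (x * R u j y)"
  by (simp add: R_def algebra_simps tr_E_left)

lemma R_equivariant_Q: "R u j (Q v js x) = Q v js (R u j x)"
  by (rule equivariant_Q_commute[OF equivariant_R])

lemma tr_Q_left: "tr (Q u js x * y) = tr (x * Q u js y)"
  by (induction js arbitrary: y) (simp_all add: tr_R_left flip: R_equivariant_Q)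

lemma R_R: "R u j (R v j x) = R (u * v) j x"
  by (simp add: R_def algebra_simps)

lemma Q_Q: "Q u js (Q v js x) = Q (u * v) js x"
proof (induction js)
  case (Cons j js)
  show ?case by (simp add: Cons R_R mult.commute flip: R_equivariant_Q)
qed simp

lemma R_1 [simp]: "R 1 j x = x" by (simp add: R_def)

lemma Q_1 [simp]: "Q 1 js x = x" by (induction js) simp_all

lemma E_e: "j < n \<Longrightarrow> E j e = e"
  using sign_part_of_eigen[of j e 1 1 1 1] by (simp add: fix_e E_def)

lemma Q_e: "set js \<subseteq> {..<n} \<Longrightarrow> Q u js e = e"
  by (induction js) (simp_all add: R_def E_e flip: scaleR_left_distrib)

lemma pos_E: "pos x \<Longrightarrow> pos (E j x)"
  unfolding E_def sign_part_def using pos_aut[OF aut(1)] pos_aut[OF aut(2)]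
  by (intro pos_scaleR pos_add) auto

lemma pos_R: "0 \<le> u \<Longrightarrow> u \<le> 1 \<Longrightarrow> pos x \<Longrightarrow> pos (R u j x)"
  unfolding R_def by (intro pos_add pos_scaleR pos_E) auto

lemma pos_Q: "0 \<le> u \<Longrightarrow> u \<le> 1 \<Longrightarrow> pos x \<Longrightarrow> pos (Q u js x)"
  by (induction js) (auto intro: pos_R)

text \<open>Split \<open>y = a + b\<close> with \<open>a = E j y\<close> and \<open>b = d j y\<close>. The mixed terms \<open>a\<^sup>\<dagger> b\<close> and \<open>b\<^sup>\<dagger> a\<close> have
  vanishing expectation, so they are multiplied by \<open>u\<close> in both terms on the left and cancel, as does
  \<open>a\<^sup>\<dagger> a\<close>. Only contributions of \<open>b\<^sup>\<dagger> b\<close> remain.\<close>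

lemma R_defect:
  "R u j (y\<^sup>\<dagger> * y) - (R u j y)\<^sup>\<dagger> * R u j y
    = (u * (1 - u)) *\<^sub>R ((d j y)\<^sup>\<dagger> * d j y) + (1 - u) *\<^sub>R E j ((d j y)\<^sup>\<dagger> * d j y)"
proof -
  define a b where "a = E j y" and "b = d j y"
  have y: "y = a + b" by (simp add: a_def b_def d_def)
  have Ea: "E j a = a" and Eb: "E j b = 0" by (simp_all add: a_def b_def)
  have 1: "E j (a\<^sup>\<dagger> * z) = a\<^sup>\<dagger> * E j z" "E j (z * a) = E j z * a" for z
    using E_bimodule(1)[of j "a\<^sup>\<dagger>" z] E_bimodule(2)[of j z a] by (simp_all add: Ea)
  have 2: "E j (b\<^sup>\<dagger> * a) = 0" "E j (a\<^sup>\<dagger> * b) = 0" "E j (a\<^sup>\<dagger> * a) = a\<^sup>\<dagger> * a"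
    by (simp_all add: 1 Ea Eb)
  show ?thesis unfolding b_def[symmetric]
    by (simp add: y R_def Ea Eb 2 algebra_simps)
qed

lemma R_defect_ge:
  assumes "0 \<le> u" "u \<le> 1"
  shows "pos (R u j (y\<^sup>\<dagger> * y) - (R u j y)\<^sup>\<dagger> * R u j y - (u * (1 - u)) *\<^sub>R ((d j y)\<^sup>\<dagger> * d j y))"
  unfolding R_defect using assms by (auto intro!: pos_scaleR pos_E)

text \<open>The Kadison--Schwarz inequality for the channel \<open>R u j\<close>.\<close>

lemma R_Schwarz:
  assumes "0 \<le> u" "u \<le> 1"
  shows "pos (R u j (y\<^sup>\<dagger> * y) - (R u j y)\<^sup>\<dagger> * R u j y)"
  unfolding R_defect using assms by (auto intro!: pos_add pos_scaleR pos_E)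

text \<open>The factor of the site \<open>i\<close> is left out of the semigroup. In this form the derivative of \<open>Q u js\<close> with
  respect to \<open>u\<close> is the sum of the \<open>dQ u js i\<close>, without division by \<open>u\<close>.\<close>

definition dQ :: "real \<Rightarrow> nat list \<Rightarrow> nat \<Rightarrow> 'a \<Rightarrow> 'a" where
  "dQ u js i x = d i (Q u (remove1 i js) x)"

lemma dQ_Cons [simp]:
  "dQ u (j # js) j x = d j (Q u js x)"
  "i \<noteq> j \<Longrightarrow> dQ u (j # js) i x = R u j (dQ u js i x)"
  by (simp_all add: dQ_def d_R_commute)

text \<open>The reverse local Poincare inequality for the semigroup. The defect of a product of channels telescopes: the
  factor \<open>R u j\<close> contributes its own defect, which dominates \<open>\<bar>d j (Q u js x)\<bar>\<^sup>2\<close>, and transports the defect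
  of the remaining factors, where the Schwarz inequality moves \<open>R u j\<close> inside the squares.\<close>

lemma gradient_estimate:
  assumes "0 \<le> u" "u \<le> 1" "distinct js"
  shows "pos (Q u js (x\<^sup>\<dagger> * x) - (Q u js x)\<^sup>\<dagger> * Q u js x
    - (u * (1 - u)) *\<^sub>R (\<Sum>i\<in>set js. (dQ u js i x)\<^sup>\<dagger> * dQ u js i x))"
  using assms(3)
proof (induction js)
  case (Cons j js)
  let ?c = "u * (1 - u)" and ?y = "Q u js x"
  let ?S = "\<Sum>i\<in>set js. (dQ u js i x)\<^sup>\<dagger> * dQ u js i x"
  have j: "j \<notin> set js" using Cons by simp
  then have step: "dQ u (j # js) i x = R u j (dQ u js i x)" if "i \<in> set js" for i
    using that by (metis dQ_Cons(2))
  have "(\<Sum>i\<in>set (j # js). (dQ u (j # js) i x)\<^sup>\<dagger> * dQ u (j # js) i x)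
      = (d j ?y)\<^sup>\<dagger> * d j ?y + (\<Sum>i\<in>set js. (R u j (dQ u js i x))\<^sup>\<dagger> * R u j (dQ u js i x))"
    using j by (simp add: step cong: sum.cong)
  moreover have "pos (R u j (Q u js (x\<^sup>\<dagger> * x) - ?y\<^sup>\<dagger> * ?y - ?c *\<^sub>R ?S)
      + (R u j (?y\<^sup>\<dagger> * ?y) - (R u j ?y)\<^sup>\<dagger> * R u j ?y - ?c *\<^sub>R ((d j ?y)\<^sup>\<dagger> * d j ?y))
      + ?c *\<^sub>R (\<Sum>i\<in>set js. R u j ((dQ u js i x)\<^sup>\<dagger> * dQ u js i x)
           - (R u j (dQ u js i x))\<^sup>\<dagger> * R u j (dQ u js i x)))"
    using Cons assms by (intro pos_add pos_R R_defect_ge pos_scaleR pos_sum R_Schwarz) auto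
  ultimately show ?case
    by (simp add: R_sum sum_subtractf algebra_simps)
qed simp

lemma tr_Q_has_derivative:
  assumes "distinct js"
  shows "((\<lambda>u. tr (x * Q u js y)) has_real_derivative (\<Sum>i\<in>set js. tr (x * dQ u js i y))) (at u)"
  using assms
proof (induction js arbitrary: x)
  case (Cons j js)
  let ?S = "\<lambda>x. \<Sum>i\<in>set js. tr (x * dQ u js i y)"
  have j: "j \<notin> set js" "distinct js" using Cons by simp_all
  then have step: "dQ u (j # js) i y = R u j (dQ u js i y)" if "i \<in> set js" for i
    using that by (metis dQ_Cons(2))
  have f: "tr (x * Q v (j # js) y) = (1 - v) * tr (E j x * Q v js y) + v * tr (x * Q v js y)" for v
    by (simp add: R_def algebra_simps tr_E_left)
  have "(\<Sum>i\<in>set (j # js). tr (x * dQ u (j # js) i y))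
      = tr (x * d j (Q u js y)) + (\<Sum>i\<in>set js. tr (x * R u j (dQ u js i y)))"
    using j by (simp add: step cong: sum.cong)
  also have "(\<Sum>i\<in>set js. tr (x * R u j (dQ u js i y))) = (1 - u) * ?S (E j x) + u * ?S x"
    by (simp add: R_def tr_E_left sum.distrib sum_distrib_left algebra_simps sum_subtractf)
  also have "tr (x * d j (Q u js y)) = - tr (E j x * Q u js y) + tr (x * Q u js y)"
    by (simp add: d_def tr_E_left algebra_simps)
  finally have D: "(\<Sum>i\<in>set (j # js). tr (x * dQ u (j # js) i y))
    = (- 1) * tr (E j x * Q u js y) + ?S (E j x) * (1 - u) + (1 * tr (x * Q u js y) + ?S x * u)"
    by (simp add: algebra_simps)
  show ?case unfolding f D
    by (rule DERIV_add DERIV_mult Cons.IH j derivative_eq_intros refl | simp)+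
qed simp

end

section \<open>Hypercontractivity and isoperimetry\<close>

context qubit_system
begin

text \<open>Expand \<open>(a + b)\<^sup>\<dagger> (a + b)\<close> into the diagonal part \<open>p\<close> and the mixed part \<open>q\<close>. The term of first order in
  \<open>b\<close> vanishes since \<open>E j b = 0\<close>; therefore no term \<open>A\<^sup>3 B\<close> occurs, and
  \<open>(A\<^sup>2 + B\<^sup>2)\<^sup>2 + 4 A B\<^sup>3 + 4 A\<^sup>2 B\<^sup>2\<close> is at most \<open>(A\<^sup>2 + 4 B\<^sup>2)\<^sup>2\<close>.\<close>

lemma nrm4_sq_add_centred:
  assumes a: "E j a = a" and b: "E j b = 0"
  shows "(nrm4 (a + b))\<^sup>2 \<le> (nrm4 a)\<^sup>2 + 4 * (nrm4 b)\<^sup>2"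
proof (rule power2_le_imp_le)
  define A where "A = nrm4 a"
  define B where "B = nrm4 b"
  have AB: "0 \<le> A" "0 \<le> B" by (simp_all add: A_def B_def)
  define p where "p = a\<^sup>\<dagger> * a + b\<^sup>\<dagger> * b"
  define q where "q = a\<^sup>\<dagger> * b + b\<^sup>\<dagger> * a"
  have np: "nrm2 p \<le> A\<^sup>2 + B\<^sup>2"
    unfolding p_def A_def B_def nrm4_sq by (rule nrm2_triangle)
  have nq: "nrm2 q \<le> 2 * A * B"
    using nrm2_triangle[of "a\<^sup>\<dagger> * b" "b\<^sup>\<dagger> * a"] nrm2_mult_le[of "a\<^sup>\<dagger>" b] nrm2_mult_le[of "b\<^sup>\<dagger>" a]
    by (simp add: q_def A_def B_def mult.commute[of "nrm4 b" "nrm4 a"])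
  have "tr ((a\<^sup>\<dagger> * a) * q) = 0"
  proof -
    have "E j (a\<^sup>\<dagger> * a) = a\<^sup>\<dagger> * a"
      using E_bimodule(1)[of j "a\<^sup>\<dagger>" a] by (simp add: a)
    moreover have "E j q = 0"
      using E_bimodule(1)[of j "a\<^sup>\<dagger>" b] E_bimodule(2)[of j "b\<^sup>\<dagger>" a] by (simp add: q_def a b)
    ultimately show ?thesis using tr_E_left[of j "a\<^sup>\<dagger> * a" q] by simp
  qed
  then have "tr (p\<^sup>\<dagger> * q) = tr ((b\<^sup>\<dagger> * b)\<^sup>\<dagger> * q)" by (simp add: p_def distrib_right)
  also have "\<dots> \<le> nrm2 (b\<^sup>\<dagger> * b) * nrm2 q" by (rule Cauchy_Schwarz)
  also have "\<dots> \<le> B\<^sup>2 * (2 * A * B)"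
    unfolding B_def nrm4_sq[symmetric] using nq by (intro mult_left_mono) (auto simp: B_def)
  finally have pq: "tr (p\<^sup>\<dagger> * q) \<le> 2 * A * B ^ 3" by (simp add: power2_eq_square power3_eq_cube mult_ac)
  have "((nrm4 (a + b))\<^sup>2)\<^sup>2 = (nrm2 (p + q))\<^sup>2"
    by (simp add: nrm4_sq p_def q_def algebra_simps)
  also have "\<dots> \<le> (A\<^sup>2 + B\<^sup>2)\<^sup>2 + 2 * (2 * A * B ^ 3) + (2 * A * B)\<^sup>2"
    unfolding nrm2_add_sq using np nq pq by (intro add_mono power_mono) auto
  also have "\<dots> \<le> (A\<^sup>2 + 4 * B\<^sup>2)\<^sup>2"
  proof -
    have "(A\<^sup>2 + 4 * B\<^sup>2)\<^sup>2 - ((A\<^sup>2 + B\<^sup>2)\<^sup>2 + 2 * (2 * A * B ^ 3) + (2 * A * B)\<^sup>2)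
        = 2 * B\<^sup>2 * (A - B)\<^sup>2 + 13 * B ^ 4"
      by (simp add: power2_eq_square power3_eq_cube power4_eq_xxxx algebra_simps)
    also have "\<dots> \<ge> 0" by simp
    finally show ?thesis by simp
  qed
  finally show "((nrm4 (a + b))\<^sup>2)\<^sup>2 \<le> ((nrm4 a)\<^sup>2 + 4 * (nrm4 b)\<^sup>2)\<^sup>2"
    by (simp add: A_def B_def)
qed simp

definition sign_sum :: "('a \<Rightarrow> real) \<Rightarrow> nat \<Rightarrow> 'a \<Rightarrow> real" where
  "sign_sum f j x = f (sign_part 1 1 j x) + f (sign_part 1 (-1) j x) + f (sign_part (-1) 1 j x) + f (sign_part (-1) (-1) j x)"

lemma sign_sum_mono:
  "(\<And>s t. f (sign_part s t j x) \<le> g (sign_part s t j x)) \<Longrightarrow> sign_sum f j x \<le> sign_sum g j x"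
  unfolding sign_sum_def by (intro add_mono)

text \<open>The one-site case of hypercontractivity. The damping \<open>1/4\<close> pays for the factor 4 of the preceding bound
  and for the factor 3 lost in splitting \<open>d j y\<close> into three sign parts: \<open>4 * 3 / 16 \<le> 1\<close>.\<close>

lemma nrm4_sq_R_le: "(nrm4 (R (1/4) j y))\<^sup>2 \<le> sign_sum (\<lambda>z. (nrm4 z)\<^sup>2) j y"
proof -
  define x1 where "x1 = sign_part 1 (-1) j y"
  define x2 where "x2 = sign_part (-1) 1 j y"
  define x3 where "x3 = sign_part (-1) (-1) j y"
  have dy: "y - E j y = x1 + x2 + x3"
    using sign_part_decomposition[of j y] by (simp add: x1_def x2_def x3_def algebra_simps)
  have R: "R (1/4) j y = E j y + (1/4) *\<^sub>R (x1 + x2 + x3)"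
    unfolding dy[symmetric] by (simp add: R_def algebra_simps flip: scaleR_left_distrib)
  have "E j ((1/4) *\<^sub>R (x1 + x2 + x3)) = 0"
    unfolding dy[symmetric] by simp
  then have "(nrm4 (R (1/4) j y))\<^sup>2 \<le> (nrm4 (E j y))\<^sup>2 + 4 * (nrm4 ((1/4) *\<^sub>R (x1 + x2 + x3)))\<^sup>2"
    unfolding R by (intro nrm4_sq_add_centred) simp_all
  also have "4 * (nrm4 ((1/4) *\<^sub>R (x1 + x2 + x3)))\<^sup>2 = (nrm4 (x1 + x2 + x3))\<^sup>2 / 4"
    by (simp add: nrm4_scaleR power2_eq_square)
  also have "(nrm4 (x1 + x2 + x3))\<^sup>2 \<le> (nrm4 x1 + nrm4 x2 + nrm4 x3)\<^sup>2"
    using nrm4_triangle[of "x1 + x2" x3] nrm4_triangle[of x1 x2] by (intro power_mono) auto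
  also have "\<dots> \<le> 3 * ((nrm4 x1)\<^sup>2 + (nrm4 x2)\<^sup>2 + (nrm4 x3)\<^sup>2)"
    using sum_squares_bound[of "nrm4 x1" "nrm4 x2"] sum_squares_bound[of "nrm4 x1" "nrm4 x3"]
      sum_squares_bound[of "nrm4 x2" "nrm4 x3"]
    by (simp add: power2_eq_square algebra_simps)
  also have "\<dots> / 4 \<le> (nrm4 x1)\<^sup>2 + (nrm4 x2)\<^sup>2 + (nrm4 x3)\<^sup>2"
    by simp
  finally show ?thesis by (simp add: sign_sum_def E_def x1_def x2_def x3_def divide_right_mono)
qed

text \<open>The squared 4-norms of all components of \<open>x\<close> in its Pauli expansion over the sites in the list, added up. It
  interpolates between \<open>(nrm4 x)\<^sup>2\<close> for the empty list and \<open>(nrm2 x)\<^sup>2\<close> for all sites, and thus allows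
  the one-site bound to be iterated.\<close>

fun mixed_norm :: "nat list \<Rightarrow> 'a \<Rightarrow> real" where
  "mixed_norm [] x = (nrm4 x)\<^sup>2"
| "mixed_norm (j # js) x = sign_sum (mixed_norm js) j x"

lemma nrm4_sq_Q_le: "(nrm4 (Q (1/4) js x))\<^sup>2 \<le> mixed_norm js x"
proof (induction js arbitrary: x)
  case (Cons j js)
  have "(nrm4 (Q (1/4) (j # js) x))\<^sup>2 \<le> sign_sum (\<lambda>z. (nrm4 z)\<^sup>2) j (Q (1/4) js x)"
    using nrm4_sq_R_le by simp
  also have "\<dots> = sign_sum (\<lambda>z. (nrm4 (Q (1/4) js z))\<^sup>2) j x"
    by (simp add: sign_sum_def equivariant_Q_commute[OF equivariant_sign_part])
  also have "\<dots> \<le> sign_sum (mixed_norm js) j x" by (intro sign_sum_mono Cons.IH)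
  finally show ?case by simp
qed simp

lemma sign_part_star: "(sign_part s t j x)\<^sup>\<dagger> = sign_part s t j (x\<^sup>\<dagger>)"
  by (simp add: sign_part_def)

lemma sign_sum_nrm2: "sign_sum (\<lambda>z. (nrm2 z)\<^sup>2) j x = (nrm2 x)\<^sup>2"
proof -
  have *: "(nrm2 (sign_part s t j x))\<^sup>2 = tr (x\<^sup>\<dagger> * sign_part s t j x)" if "s\<^sup>2 = 1" "t\<^sup>2 = 1" for s t
    by (simp add: nrm2_sq sign_part_star tr_sign_part_left that)
  have "sign_sum (\<lambda>z. (nrm2 z)\<^sup>2) j x
      = tr (x\<^sup>\<dagger> * (E j x + sign_part 1 (-1) j x + sign_part (-1) 1 j x + sign_part (-1) (-1) j x))"
    by (simp add: sign_sum_def * E_def distrib_left)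
  then show ?thesis by (simp add: sign_part_decomposition nrm2_sq)
qed

text \<open>Being an eigenvector of both automorphisms at site \<open>j\<close> means being, up to a factor commuting with that site,
  a single Pauli matrix there.\<close>

definition eigen :: "nat \<Rightarrow> 'a \<Rightarrow> bool" where
  "eigen j x \<longleftrightarrow> (\<exists>s t. s\<^sup>2 = 1 \<and> t\<^sup>2 = 1 \<and> \<alpha> j x = s *\<^sub>R x \<and> \<beta> j x = t *\<^sub>R x)"

text \<open>A joint eigenvector for all sites is a multiple of a unitary, like a tensor product of Pauli matrices: the
  element \<open>x\<^sup>\<dagger> x\<close> is fixed by all the automorphisms, hence a scalar.\<close>

lemma nrm4_eq_nrm2_of_eigen:
  assumes x: "x * e = x" and ev: "\<And>j. j < n \<Longrightarrow> eigen j x"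
  shows "nrm4 x = nrm2 x"
proof -
  have "\<alpha> j (x\<^sup>\<dagger> * x) = x\<^sup>\<dagger> * x" "\<beta> j (x\<^sup>\<dagger> * x) = x\<^sup>\<dagger> * x" if "j < n" for j
    using ev[OF that] by (auto simp: eigen_def power2_eq_square)
  then obtain c where c: "x\<^sup>\<dagger> * x = c *\<^sub>R e"
    using ergodic[of "x\<^sup>\<dagger> * x"] x by (auto simp: mult.assoc)
  have "c = (nrm2 x)\<^sup>2" by (simp add: nrm2_sq c)
  then have "nrm2 (x\<^sup>\<dagger> * x) = (nrm2 x)\<^sup>2" unfolding c by (simp add: nrm2_scaleR) (simp add: nrm2_def)
  then show ?thesis by (simp add: nrm4_def)
qed

lemma sign_part_times_e: "j < n \<Longrightarrow> x * e = x \<Longrightarrow> sign_part s t j x * e = sign_part s t j x"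
proof -
  assume j: "j < n" and x: "x * e = x"
  have "\<alpha> j y * e = \<alpha> j y" if "y * e = y" for y
    using arg_cong[OF that, of "\<alpha> j"] j by (simp add: fix_e)
  moreover have "\<beta> j y * e = \<beta> j y" if "y * e = y" for y
    using arg_cong[OF that, of "\<beta> j"] j by (simp add: fix_e)
  ultimately show ?thesis using x by (simp add: sign_part_def distrib_right)
qed

lemma eigen_sign_part_self: "s\<^sup>2 = 1 \<Longrightarrow> t\<^sup>2 = 1 \<Longrightarrow> eigen j (sign_part s t j x)"
  unfolding eigen_def using sign_part_eigen by blast

lemma eigen_sign_part: "eigen i x \<Longrightarrow> eigen i (sign_part s t j x)"
  unfolding eigen_def
  using equivariant_sign_part_commute[OF equivariant_\<alpha>, of i s t j x]
    equivariant_sign_part_commute[OF equivariant_\<beta>, of i s t j x] sign_part_linear(2) by metis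

lemma mixed_norm_eq_nrm2_sq:
  assumes "x * e = x" "set js \<subseteq> {..<n}" "\<And>j. j < n \<Longrightarrow> j \<notin> set js \<Longrightarrow> eigen j x"
  shows "mixed_norm js x = (nrm2 x)\<^sup>2"
  using assms
proof (induction js arbitrary: x)
  case Nil
  then show ?case by (simp add: nrm4_eq_nrm2_of_eigen)
next
  case (Cons j js)
  have "mixed_norm js (sign_part s t j x) = (nrm2 (sign_part s t j x))\<^sup>2" if st: "s\<^sup>2 = 1" "t\<^sup>2 = 1" for s t
  proof (rule Cons.IH)
    show "sign_part s t j x * e = sign_part s t j x" using Cons.prems by (intro sign_part_times_e) auto
    fix i assume "i < n" "i \<notin> set js"
    then show "eigen i (sign_part s t j x)"
      using Cons.prems(3)[of i] eigen_sign_part_self[OF st] eigen_sign_part by (cases "i = j") auto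
  qed (use Cons.prems in auto)
  then have "mixed_norm (j # js) x = sign_sum (\<lambda>z. (nrm2 z)\<^sup>2) j x"
    by (simp add: sign_sum_def)
  then show ?case by (simp add: sign_sum_nrm2)
qed

text \<open>A noncommutative form of the Bonami inequality between \<open>L\<^sub>2\<close> and \<open>L\<^sub>4\<close>.\<close>

lemma hypercontractivity:
  assumes "x * e = x"
  shows "(nrm4 (Q (1/4) [0..<n] x))\<^sup>2 \<le> (nrm2 x)\<^sup>2"
  using nrm4_sq_Q_le[of "[0..<n]" x] mixed_norm_eq_nrm2_sq[OF assms, of "[0..<n]"]
  by (simp add: subset_iff)

definition stability :: "'a \<Rightarrow> real \<Rightarrow> real" where
  "stability T u = tr (T * Q u [0..<n] T)"

lemma stability_square:
  assumes T: "T\<^sup>\<dagger> = T"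
  shows "stability T (v\<^sup>2) = (nrm2 (Q v [0..<n] T))\<^sup>2"
  using tr_Q_left[of v "[0..<n]" T "Q v [0..<n] T"]
  by (simp add: stability_def nrm2_sq Q_star[symmetric] T Q_Q del: Q_star) (simp add: power2_eq_square)

text \<open>By the semigroup law, \<open>stability T (v\<^sup>2)\<close> is the squared 2-norm of \<open>Q v T\<close>, so this is Cauchy--Schwarz.\<close>

lemma stability_log_convex:
  assumes T: "T\<^sup>\<dagger> = T"
  shows "(stability T v)\<^sup>2 \<le> stability T 1 * stability T (v\<^sup>2)"
proof -
  have "(stability T v)\<^sup>2 \<le> (\<Sum>_\<in>{()}. tr (T\<^sup>\<dagger> * T)) * (\<Sum>_\<in>{()}. tr ((Q v [0..<n] T)\<^sup>\<dagger> * Q v [0..<n] T))"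
    using tr_Cauchy_Schwarz_sum[of "\<lambda>_. T" "\<lambda>_. Q v [0..<n] T" "{()}"] by (simp add: stability_def T)
  then show ?thesis using T by (simp add: stability_square nrm2_sq) (simp add: stability_def)
qed

context
  fixes T
  assumes T: "T\<^sup>\<dagger> = T" "T * T = T" "T * e = T"
begin

lemma stability_1: "stability T 1 = tr T"
  by (simp add: stability_def T)

lemma tr_T_nonneg: "0 \<le> tr T"
  using tr_square_nonneg[of T] by (simp add: T)

text \<open>Hoelder with exponents \<open>4/3\<close> and 4, then hypercontractivity: \<open>tr (T g) \<le> \<tau>\<^sup>3\<^sup>/\<^sup>4 \<parallel>g\<parallel>\<^sub>4\<close> and
  \<open>\<parallel>g\<parallel>\<^sub>4 \<le> \<parallel>T\<parallel>\<^sub>2 = \<tau>\<^sup>1\<^sup>/\<^sup>2\<close> for \<open>g = Q T\<close> and \<open>\<tau> = tr T\<close>.\<close>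

lemma small_set_expansion_base: "stability T (1/4) \<le> tr T * tr T powr (1/4)"
proof (cases "tr T = 0")
  case True
  have "(stability T (1/4))\<^sup>2 \<le> 0"
    using stability_log_convex[OF T(1), of "1/4"] by (simp add: stability_1 True)
  then show ?thesis using True by simp
next
  case False
  let ?\<tau> = "tr T"
  have pos: "0 < ?\<tau>" using False tr_T_nonneg by simp
  have n2: "nrm2 T = ?\<tau> powr (1/2)" by (simp add: nrm2_def T powr_half_sqrt[OF tr_T_nonneg])
  have "(stability T (1/4))\<^sup>2 \<le> ?\<tau> * (nrm2 T * (nrm4 (Q (1/4) [0..<n] T))\<^sup>2)"
    unfolding stability_def by (rule tr_projection_le[OF T(1,2)])
  also have "\<dots> \<le> ?\<tau> * (nrm2 T * (nrm2 T)\<^sup>2)"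
    using hypercontractivity[OF T(3)] tr_T_nonneg by (intro mult_left_mono) auto
  also have "\<dots> = (?\<tau> * ?\<tau> powr (1/4))\<^sup>2"
    unfolding n2 power2_eq_square using pos
    by (simp add: powr_add[symmetric] powr_mult_base field_simps)
  finally show ?thesis by (rule power2_le_imp_le) (use pos in auto)
qed

lemma small_set_expansion:
  "stability T ((1/4) powr (1 / 2 ^ m)) \<le> tr T * tr T powr (1 / (4 * 2 ^ m))"
proof (induction m)
  case 0
  then show ?case using small_set_expansion_base by simp
next
  case (Suc m)
  let ?\<tau> = "tr T" and ?v = "(1/4 :: real) powr (1 / 2 ^ Suc m)"
  have v: "?v\<^sup>2 = (1/4) powr (1 / 2 ^ m)"
    by (simp add: power2_eq_square powr_add[symmetric] field_simps)
  have "(stability T ?v)\<^sup>2 \<le> ?\<tau> * stability T (?v\<^sup>2)"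
    using stability_log_convex[OF T(1), of ?v] by (simp only: stability_1)
  also have "\<dots> \<le> ?\<tau> * (?\<tau> * ?\<tau> powr (1 / (4 * 2 ^ m)))"
    unfolding v by (intro mult_left_mono Suc tr_T_nonneg)
  also have "\<dots> = (?\<tau> * ?\<tau> powr (1 / (4 * 2 ^ Suc m)))\<^sup>2"
    by (simp add: power2_eq_square powr_add[symmetric] mult.assoc mult.left_commute field_simps)
  finally show ?case by (rule power2_le_imp_le) (use tr_T_nonneg in auto)
qed

context
  fixes G :: real
  assumes G: "\<And>b C. 0 \<le> C \<Longrightarrow> pos (C *\<^sub>R e - (\<Sum>j<n. (b j)\<^sup>\<dagger> * b j)) \<Longrightarrow>
    (\<Sum>j<n. tr ((d j T)\<^sup>\<dagger> * b j)) \<le> sqrt C * G"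
begin

text \<open>The derivative is the pairing of the column \<open>d j T\<close> with the column \<open>dQ u j T\<close>. The gradient estimate
  with \<open>x = T\<close>, together with \<open>Q u T \<le> e\<close>, shows that the squares of the latter add up to at most
  \<open>e / (u (1 - u))\<close>. The constant \<open>G\<close> stands for the \<open>L\<^sub>1\<close>-norm of the
  gradient, which enters through this duality.\<close>

lemma stability_has_derivative_le:
  assumes u: "0 < u" "u < 1"
  obtains D where "(stability T has_real_derivative D) (at u)" "D \<le> G / sqrt (u * (1 - u))"
proof
  let ?js = "[0..<n]" and ?c = "u * (1 - u)"
  let ?B = "\<lambda>i. dQ u ?js i T"
  have c: "0 < ?c" using u by simp
  have js: "set ?js = {..<n}" by auto
  show "(stability T has_real_derivative (\<Sum>i<n. tr (T * ?B i))) (at u)"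
    unfolding stability_def using tr_Q_has_derivative[of ?js T T u] by (simp add: js[symmetric] del: set_upt)
  have e: "pos (e - Q u ?js T)"
  proof -
    have "e * T = T" using star_mult[of T e] T by (simp del: star_mult)
    then have "(e - T)\<^sup>\<dagger> * (e - T) = e - T" using T by (simp add: algebra_simps)
    then have "pos (e - T)" by (metis pos_square)
    then have "pos (Q u ?js (e - T))" using u by (intro pos_Q) auto
    then show ?thesis by (simp add: Q_e js del: set_upt)
  qed
  have "pos ((Q u ?js (T\<^sup>\<dagger> * T) - (Q u ?js T)\<^sup>\<dagger> * Q u ?js T - ?c *\<^sub>R (\<Sum>i\<in>set ?js. (?B i)\<^sup>\<dagger> * ?B i))
      + (Q u ?js T)\<^sup>\<dagger> * Q u ?js T + (e - Q u ?js T))"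
    using u e by (intro pos_add gradient_estimate) auto
  then have "pos (e - ?c *\<^sub>R (\<Sum>i<n. (?B i)\<^sup>\<dagger> * ?B i))"
    by (simp add: T js del: set_upt)
  then have "pos ((1 / ?c) *\<^sub>R (e - ?c *\<^sub>R (\<Sum>i<n. (?B i)\<^sup>\<dagger> * ?B i)))"
    using c by (intro pos_scaleR) auto
  then have "pos ((1 / ?c) *\<^sub>R e - (\<Sum>i<n. (?B i)\<^sup>\<dagger> * ?B i))"
    using u by (simp add: scaleR_diff_right)
  then have "(\<Sum>j<n. tr ((d j T)\<^sup>\<dagger> * ?B j)) \<le> sqrt (1 / ?c) * G"
    using c by (intro G) auto
  also have "(\<Sum>j<n. tr ((d j T)\<^sup>\<dagger> * ?B j)) = (\<Sum>j<n. tr (T * ?B j))"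
    by (simp add: d_star[symmetric] T tr_d_left dQ_def del: d_star)
  finally show "(\<Sum>j<n. tr (T * ?B j)) \<le> G / sqrt ?c" by (simp add: real_sqrt_divide)
qed

text \<open>For \<open>u \<ge> 1/4\<close> the derivative is at most \<open>2 G / sqrt (1 - u)\<close>, which is the derivative of
  \<open>- 4 G sqrt (1 - u)\<close>.\<close>

lemma stability_increment_le:
  assumes r: "1/4 \<le> r" "r < 1"
  shows "stability T 1 - stability T r \<le> 4 * G * sqrt (1 - r)"
proof -
  define g where "g u = stability T u + 4 * G * sqrt (1 - u)" for u
  have G0: "0 \<le> G" using G[of 1 "\<lambda>_. 0"] pos_square[of e] by simp
  have cont: "continuous_on {r..1} g"
  proof -
    have "isCont (stability T) u" for u
      unfolding stability_def by (rule DERIV_isCont[OF tr_Q_has_derivative]) simp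
    then have "continuous_on {r..1} (stability T)"
      by (intro continuous_at_imp_continuous_on) simp
    then show ?thesis unfolding g_def by (intro continuous_intros)
  qed
  have "g 1 \<le> g r"
  proof (rule DERIV_nonpos_imp_decreasing_open[OF _ _ cont])
    fix u assume u: "r < u" "u < 1"
    obtain D where D: "(stability T has_real_derivative D) (at u)" "D \<le> G / sqrt (u * (1 - u))"
      using stability_has_derivative_le[of u] u r by auto
    have "(g has_real_derivative D + 4 * G * (- 1 * (inverse (sqrt (1 - u)) / 2))) (at u)"
      unfolding g_def using u by (auto intro!: derivative_eq_intros D(1))
    moreover have "D + 4 * G * (- 1 * (inverse (sqrt (1 - u)) / 2)) \<le> 0"
    proof -
      have "1 / 2 * sqrt (1 - u) \<le> sqrt (u * (1 - u))"
      proof -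
        have "1/4 * (1 - u) \<le> u * (1 - u)" using u r by (intro mult_right_mono) auto
        from real_sqrt_le_mono[OF this] show ?thesis by (simp only: real_sqrt_mult) (simp add: real_sqrt_divide)
      qed
      then have "G / sqrt (u * (1 - u)) \<le> G / (1 / 2 * sqrt (1 - u))"
        using u G0 r by (intro divide_left_mono) auto
      then show ?thesis using D(2) by (simp add: field_simps)
    qed
    ultimately show "\<exists>y. (g has_real_derivative y) (at u) \<and> y \<le> 0" by blast
  qed (use r in auto)
  then show ?thesis by (simp add: g_def)
qed

lemma isoperimetry_small:
  assumes \<tau>: "0 < tr T" "tr T \<le> 1/2"
  shows "tr T * sqrt (ln (1 / tr T)) \<le> 36 * sqrt 2 * G"
proof -
  define L where "L = ln (1 / tr T)"
  have L: "1/2 \<le> L"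
  proof -
    have "1/2 \<le> ln (2::real)" using exp_half_le2 by (subst ln_ge_iff) auto
    also have "\<dots> \<le> L" unfolding L_def using \<tau> by (intro ln_mono) (auto simp: field_simps)
    finally show ?thesis .
  qed
  \<comment> \<open>The noise level \<open>h\<close> below lies between \<open>1 / (2 * L)\<close> and \<open>1 / L\<close>: then \<open>tr T powr (h / 4)\<close> is
     bounded away from 1, while \<open>1 - r\<close> is of the order of \<open>1 / L\<close>.\<close>
  obtain m where m: "2 ^ m \<le> nat \<lfloor>2 * L\<rfloor>" "nat \<lfloor>2 * L\<rfloor> < 2 ^ (m + 1)"
    using ex_power_ivl1[of 2 "nat \<lfloor>2 * L\<rfloor>"] L by (auto simp: le_nat_iff le_floor_iff)
  define h :: real where "h = 1 / 2 ^ m"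
  have m1: "2 ^ m \<le> 2 * L"
  proof -
    have "int (2 ^ m) \<le> \<lfloor>2 * L\<rfloor>" using m(1) L by (subst (asm) le_nat_iff) auto
    then show ?thesis by (simp add: le_floor_iff)
  qed
  have m2: "L < 2 ^ m"
  proof -
    have "\<lfloor>2 * L\<rfloor> < 2 ^ (m + 1)" using m(2) L by (subst (asm) nat_less_iff) auto
    then have "2 * L < 2 ^ (m + 1)" by (simp add: floor_less_iff)
    then show ?thesis by simp
  qed
  have h: "0 < h" "h \<le> 1" "h \<le> 1 / L" "1 / (2 * L) \<le> h"
    using m1 m2 L by (auto simp: h_def field_simps)
  define r :: real where "r = (1/4) powr h"
  have r: "1/4 \<le> r" "r < 1"
    using h powr_mono'[of h 1 "1/4::real"] by (auto simp: r_def powr01_less_one)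
  have "1 - r \<le> 2 / L"
  proof -
    have "1 - r \<le> - ln r" using ln_le_minus_one[of r] r by simp
    also have "\<dots> = h * (2 * ln 2)"
      using ln_powr[of "1/4::real" h] ln_realpow[of 2 2] by (simp add: r_def ln_div)
    also have "\<dots> \<le> (1 / L) * (2 * 1)"
      using h L ln_2_less_1 by (intro mult_mono) auto
    finally show ?thesis by simp
  qed
  then have "sqrt (1 - r) \<le> sqrt 2 / sqrt L"
    by (metis real_sqrt_divide real_sqrt_le_mono)
  moreover have G0: "0 \<le> G" using G[of 1 "\<lambda>_. 0"] pos_square[of e] by simp
  ultimately have "4 * G * sqrt (1 - r) \<le> 4 * G * (sqrt 2 / sqrt L)"
    by (intro mult_left_mono) auto
  moreover have "tr T / 9 \<le> stability T 1 - stability T r"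
  proof -
    have "tr T powr (h / 4) \<le> 8/9"
    proof -
      have "tr T powr (h / 4) = exp (- (h * L / 4))"
        using \<tau> by (simp add: powr_def L_def ln_div)
      also have "\<dots> \<le> exp (- (1/8))"
        using h L by (simp add: field_simps)
      also have "\<dots> \<le> 8/9"
        using exp_ge_add_one_self[of "1/8::real"] by (simp add: exp_minus field_simps)
      finally show ?thesis .
    qed
    moreover have "stability T r \<le> tr T * tr T powr (h / 4)"
      using small_set_expansion[of m] by (simp add: r_def h_def mult.commute)
    ultimately have "stability T r \<le> tr T * (8/9)"
      using \<tau> by (meson mult_left_mono order.trans less_imp_le)
    then show ?thesis by (simp add: stability_1)
  qed
  ultimately have "tr T / 9 \<le> 4 * G * (sqrt 2 / sqrt L)"
    using stability_increment_le[OF r] by linarith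
  then show ?thesis using L by (simp add: L_def[symmetric] field_simps)
qed

end
end

text \<open>For \<open>tr T \<le> 1/2\<close> the variance is comparable to the trace, up to a factor 2 that changes the logarithm by at
  most a factor 2 as well. Otherwise replace \<open>T\<close> by its complement, whose partial derivatives differ from those of \<open>T\<close> only in sign. The
  right-hand side is 72 times the trace of the square root of \<open>\<Sum>\<^sub>j \<bar>d j T\<bar>\<^sup>2\<close>, written with a spectral
  resolution.\<close>

theorem projection_isoperimetry:
  assumes T: "T\<^sup>\<dagger> = T" "T * T = T" "T * e = T"
    and I: "finite I"
    and p: "\<And>i. i \<in> I \<Longrightarrow> (p i)\<^sup>\<dagger> = p i" "\<And>i. i \<in> I \<Longrightarrow> p i * p i = p i"
    and pe: "(\<Sum>i\<in>I. p i) = e" "\<And>i. i \<in> I \<Longrightarrow> e * p i = p i"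
    and s: "\<And>i. i \<in> I \<Longrightarrow> 0 \<le> s i"
      "\<And>i. i \<in> I \<Longrightarrow> tr (p i * (\<Sum>j<n. (d j T)\<^sup>\<dagger> * d j T) * p i) = (s i)\<^sup>2 * tr (p i)"
  defines "v \<equiv> tr T - (tr T)\<^sup>2"
  shows "v * sqrt (ln (1 / v)) \<le> 72 * (\<Sum>i\<in>I. s i * tr (p i))"
proof -
  let ?G = "\<Sum>i\<in>I. s i * tr (p i)"
  have G: "(\<Sum>j<n. tr ((d j T)\<^sup>\<dagger> * b j)) \<le> sqrt C * ?G"
    if "0 \<le> C" "pos (C *\<^sub>R e - (\<Sum>j<n. (b j)\<^sup>\<dagger> * b j))" for b C
    by (rule column_duality[OF I p pe _ s that(2,1)])
      (use T(3) in \<open>auto simp: d_def E_def left_diff_distrib sign_part_times_e\<close>)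
  have G0: "0 \<le> ?G" using G[of 1 "\<lambda>_. 0"] pos_square[of e] by simp
  have small: "v * sqrt (ln (1 / v)) \<le> 72 * ?G"
    if S: "S\<^sup>\<dagger> = S" "S * S = S" "S * e = S" and v: "v = tr S - (tr S)\<^sup>2" and half: "tr S \<le> 1/2"
      and GS: "\<And>b C. 0 \<le> C \<Longrightarrow> pos (C *\<^sub>R e - (\<Sum>j<n. (b j)\<^sup>\<dagger> * b j)) \<Longrightarrow>
        (\<Sum>j<n. tr ((d j S)\<^sup>\<dagger> * b j)) \<le> sqrt C * ?G" for S
  proof (cases "tr S = 0")
    case True
    then show ?thesis using G0 by (simp add: v)
  next
    case False
    let ?t = "tr S"
    have t: "0 < ?t" using False tr_T_nonneg[OF S] by simp
    have v1: "v \<le> ?t" "?t / 2 \<le> v" "0 < v"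
    proof -
      have "?t * ?t \<le> ?t * (1/2)" using t half by (intro mult_left_mono) auto
      then show "?t / 2 \<le> v" by (simp add: v power2_eq_square)
      then show "0 < v" using t by linarith
    qed (simp add: v)
    have "ln (1 / v) \<le> ln ((1 / ?t) * 2)"
      using v1 t by (intro ln_mono) (auto simp: field_simps)
    also have "\<dots> = ln (1 / ?t) + ln 2" using t by (subst ln_mult) auto
    also have "ln 2 \<le> ln (1 / ?t)" using t half by (intro ln_mono) (auto simp: field_simps)
    finally have "sqrt (ln (1 / v)) \<le> sqrt (2 * ln (1 / ?t))" by simp
    then have "v * sqrt (ln (1 / v)) \<le> ?t * (sqrt 2 * sqrt (ln (1 / ?t)))"
      using v1 t half unfolding real_sqrt_mult
      by (intro mult_mono) (auto simp: ln_ge_zero field_simps)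
    also have "\<dots> \<le> sqrt 2 * (36 * sqrt 2 * ?G)"
      using isoperimetry_small[OF S GS t half] by (simp add: mult.left_commute)
    also have "\<dots> = 36 * (sqrt 2 * sqrt 2) * ?G" by (simp only: mult_ac)
    finally show ?thesis by simp
  qed
  show ?thesis
  proof (cases "tr T \<le> 1/2")
    case True
    show ?thesis by (rule small[OF T _ True G]) (simp_all add: v_def)
  next
    case False
    have eT: "e * T = T" using star_mult[of T e] T by (simp del: star_mult)
    show ?thesis
    proof (rule small[of "e - T"])
      show "(e - T)\<^sup>\<dagger> = e - T" "(e - T) * (e - T) = e - T" "(e - T) * e = e - T"
        using T eT by (simp_all add: algebra_simps)
      show "v = tr (e - T) - (tr (e - T))\<^sup>2" by (simp add: v_def power2_eq_square algebra_simps)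
      show "tr (e - T) \<le> 1/2" using False by simp
      fix b C assume "0 \<le> C" "pos (C *\<^sub>R e - (\<Sum>j<n. (b j)\<^sup>\<dagger> * b j))"
      then show "(\<Sum>j<n. tr ((d j (e - T))\<^sup>\<dagger> * b j)) \<le> sqrt C * ?G"
        using G[of C "\<lambda>j. - b j"] by (simp add: d_def E_e algebra_simps)
    qed
  qed
qed

end

section \<open>Finitely supported matrices\<close>

text \<open>One type for all numbers of qubits, on which the ring laws hold without side conditions on dimensions. The
  price is the lack of a unit; the unit matrices of the corners take its place.\<close>

typedef fmat = "{f :: nat \<Rightarrow> nat \<Rightarrow> complex. finite {(r, c). f r c \<noteq> 0}}"
  morphisms entry Fmat
  by (rule exI[of _ "\<lambda>_ _. 0"]) simp

lemma fmat_eqI: "(\<And>r c. entry x r c = entry y r c) \<Longrightarrow> x = y"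
  by (simp add: entry_inject[symmetric] ext)

lemma finite_entry: "finite {(r, c). entry x r c \<noteq> 0}"
  using entry[of x] by simp

lemma entry_Fmat:
  assumes "finite K" "\<And>r c. f r c \<noteq> 0 \<Longrightarrow> r \<in> K \<and> c \<in> K"
  shows "entry (Fmat f) = f"
proof (rule Fmat_inverse)
  have "{(r, c). f r c \<noteq> 0} \<subseteq> K \<times> K" using assms(2) by auto
  then show "f \<in> {f. finite {(r, c). f r c \<noteq> 0}}"
    using assms(1) by (simp add: finite_subset)
qed

text \<open>A finite set that contains the row and column indices of all nonzero entries. Sums over \<open>k\<close> in products and
  traces can be taken over any finite set that is large enough.\<close>

definition idx :: "fmat \<Rightarrow> nat set" where
  "idx x = fst ` {(r, c). entry x r c \<noteq> 0} \<union> snd ` {(r, c). entry x r c \<noteq> 0}"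

lemma finite_idx [simp]: "finite (idx x)"
  by (simp add: idx_def finite_entry)

lemma idx: "entry x r c \<noteq> 0 \<Longrightarrow> r \<in> idx x" "entry x r c \<noteq> 0 \<Longrightarrow> c \<in> idx x"
  by (force simp: idx_def)+

lemma entry_outside: "k \<notin> idx x \<Longrightarrow> entry x k c = 0" "k \<notin> idx x \<Longrightarrow> entry x r k = 0"
  using idx by blast+

instantiation fmat :: real_algebra
begin

definition "0 = Fmat (\<lambda>r c. 0)"
definition "x + y = Fmat (\<lambda>r c. entry x r c + entry y r c)"
definition "- x = Fmat (\<lambda>r c. - entry x r c)"
definition "x - y = Fmat (\<lambda>r c. entry x r c - entry y r c)"
definition "a *\<^sub>R x = Fmat (\<lambda>r c. a *\<^sub>R entry x r c)"
definition "x * y = Fmat (\<lambda>r c. \<Sum>k\<in>idx x. entry x r k * entry y k c)"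

lemma entry_simps [simp]:
  "entry 0 r c = 0"
  "entry (x + y) r c = entry x r c + entry y r c"
  "entry (- x) r c = - entry x r c"
  "entry (x - y) r c = entry x r c - entry y r c"
  "entry (a *\<^sub>R x) r c = a *\<^sub>R entry x r c"
proof -
  show "entry 0 r c = 0"
    unfolding zero_fmat_def by (subst entry_Fmat[of "{}"]) auto
  have *: "r \<in> idx x \<union> idx y \<and> c \<in> idx x \<union> idx y" if "entry x r c \<noteq> 0 \<or> entry y r c \<noteq> 0" for r c
    using that idx by auto
  show "entry (x + y) r c = entry x r c + entry y r c"
    unfolding plus_fmat_def by (subst entry_Fmat[of "idx x \<union> idx y"]) (simp, rule *, auto)
  show "entry (- x) r c = - entry x r c"
    unfolding uminus_fmat_def by (subst entry_Fmat[of "idx x"]) (auto simp: idx)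
  show "entry (x - y) r c = entry x r c - entry y r c"
    unfolding minus_fmat_def by (subst entry_Fmat[of "idx x \<union> idx y"]) (simp, rule *, auto)
  show "entry (a *\<^sub>R x) r c = a *\<^sub>R entry x r c"
    unfolding scaleR_fmat_def by (subst entry_Fmat[of "idx x"]) (auto simp: idx)
qed

lemma entry_mult:
  assumes K: "finite K" "\<And>k. k \<notin> K \<Longrightarrow> entry x r k = 0 \<or> entry y k c = 0"
  shows "entry (x * y) r c = (\<Sum>k\<in>K. entry x r k * entry y k c)"
proof -
  have "entry (x * y) r c = (\<Sum>k\<in>idx x. entry x r k * entry y k c)"
    unfolding times_fmat_def
  proof (subst entry_Fmat[of "idx x \<union> idx y"])
    fix r c assume "(\<Sum>k\<in>idx x. entry x r k * entry y k c) \<noteq> 0"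
    then obtain k where "entry x r k * entry y k c \<noteq> 0"
      by (meson sum.not_neutral_contains_not_neutral)
    then show "r \<in> idx x \<union> idx y \<and> c \<in> idx x \<union> idx y"
      using idx(1)[of x r k] idx(2)[of y k c] by auto
  qed auto
  also have "\<dots> = (\<Sum>k\<in>idx x \<union> K. entry x r k * entry y k c)"
    using K(1) by (intro sum.mono_neutral_left) (auto simp: entry_outside)
  also have "\<dots> = (\<Sum>k\<in>K. entry x r k * entry y k c)"
    using K by (intro sum.mono_neutral_right) auto
  finally show ?thesis .
qed

instance
proof
  fix x y z :: fmat and a b :: real
  let ?K = "idx x \<union> idx y \<union> idx z"
  have K: "finite ?K" by simp
  have xy: "entry (x * y) r c = (\<Sum>k\<in>?K. entry x r k * entry y k c)" for r c
    by (rule entry_mult[OF K]) (auto simp: entry_outside)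
  have yz: "entry (y * z) r c = (\<Sum>k\<in>?K. entry y r k * entry z k c)" for r c
    by (rule entry_mult[OF K]) (auto simp: entry_outside)
  have xz: "entry (x * z) r c = (\<Sum>k\<in>?K. entry x r k * entry z k c)" for r c
    by (rule entry_mult[OF K]) (auto simp: entry_outside)
  show "x * y * z = x * (y * z)"
  proof (rule fmat_eqI)
    fix r c
    have "entry (x * y * z) r c = (\<Sum>l\<in>?K. entry (x * y) r l * entry z l c)"
      by (rule entry_mult[OF K]) (auto simp: entry_outside)
    also have "\<dots> = (\<Sum>l\<in>?K. \<Sum>k\<in>?K. entry x r k * (entry y k l * entry z l c))"
      by (simp add: xy sum_distrib_right mult.assoc)
    also have "\<dots> = (\<Sum>k\<in>?K. \<Sum>l\<in>?K. entry x r k * (entry y k l * entry z l c))"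
      by (rule sum.swap)
    also have "\<dots> = (\<Sum>k\<in>?K. entry x r k * entry (y * z) k c)"
      by (simp add: yz sum_distrib_left)
    also have "\<dots> = entry (x * (y * z)) r c"
      by (rule entry_mult[OF K, symmetric]) (auto simp: entry_outside)
    finally show "entry (x * y * z) r c = entry (x * (y * z)) r c" .
  qed
  show "(x + y) * z = x * z + y * z"
  proof (rule fmat_eqI)
    fix r c
    have "entry ((x + y) * z) r c = (\<Sum>k\<in>?K. entry (x + y) r k * entry z k c)"
      by (rule entry_mult[OF K]) (auto simp: entry_outside)
    then show "entry ((x + y) * z) r c = entry (x * z + y * z) r c"
      by (simp add: xz yz distrib_right sum.distrib)
  qed
  show "x * (y + z) = x * y + x * z"
  proof (rule fmat_eqI)
    fix r c
    have "entry (x * (y + z)) r c = (\<Sum>k\<in>?K. entry x r k * entry (y + z) k c)"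
      by (rule entry_mult[OF K]) (auto simp: entry_outside)
    then show "entry (x * (y + z)) r c = entry (x * y + x * z) r c"
      by (simp add: xy xz distrib_left sum.distrib)
  qed
  show "a *\<^sub>R x * y = a *\<^sub>R (x * y)"
  proof (rule fmat_eqI)
    fix r c
    have "entry (a *\<^sub>R x * y) r c = (\<Sum>k\<in>?K. entry (a *\<^sub>R x) r k * entry y k c)"
      by (rule entry_mult[OF K]) (auto simp: entry_outside)
    then show "entry (a *\<^sub>R x * y) r c = entry (a *\<^sub>R (x * y)) r c"
      by (simp add: xy scaleR_sum_right)
  qed
  show "x * a *\<^sub>R y = a *\<^sub>R (x * y)"
  proof (rule fmat_eqI)
    fix r c
    have "entry (x * a *\<^sub>R y) r c = (\<Sum>k\<in>?K. entry x r k * entry (a *\<^sub>R y) k c)"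
      by (rule entry_mult[OF K]) (auto simp: entry_outside)
    then show "entry (x * a *\<^sub>R y) r c = entry (a *\<^sub>R (x * y)) r c"
      by (simp add: xy scaleR_sum_right)
  qed
  show "x + y + z = x + (y + z)" "x + y = y + x" "0 + x = x" "- x + x = 0" "x - y = x + - y"
    by (rule fmat_eqI; simp)+
  show "a *\<^sub>R (x + y) = a *\<^sub>R x + a *\<^sub>R y" "(a + b) *\<^sub>R x = a *\<^sub>R x + b *\<^sub>R x"
    "a *\<^sub>R b *\<^sub>R x = (a * b) *\<^sub>R x" "1 *\<^sub>R x = x"
    by (rule fmat_eqI; simp add: scaleR_add_left scaleR_add_right)+
qed

end

definition adj :: "fmat \<Rightarrow> fmat" where "adj x = Fmat (\<lambda>r c. cnj (entry x c r))"

lemma entry_adj [simp]: "entry (adj x) r c = cnj (entry x c r)"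
  unfolding adj_def by (subst entry_Fmat[of "idx x"]) (auto simp: idx)

definition Tr :: "fmat \<Rightarrow> complex" where "Tr x = (\<Sum>r\<in>idx x. entry x r r)"

lemma Tr_eq:
  assumes "finite K" "\<And>r. r \<notin> K \<Longrightarrow> entry x r r = 0"
  shows "Tr x = (\<Sum>r\<in>K. entry x r r)"
proof -
  have "Tr x = (\<Sum>r\<in>idx x \<union> K. entry x r r)"
    unfolding Tr_def using assms(1) by (intro sum.mono_neutral_left) (auto simp: entry_outside)
  also have "\<dots> = (\<Sum>r\<in>K. entry x r r)"
    using assms by (intro sum.mono_neutral_right) auto
  finally show ?thesis .
qed

text \<open>Only the normalization depends on \<open>n\<close>. The sum runs over the whole diagonal, since a trace cut off at
  \<open>2\<^sup>n\<close> would not be cyclic on all of \<^typ>\<open>fmat\<close>.\<close>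

definition ntrace :: "nat \<Rightarrow> fmat \<Rightarrow> real" where "ntrace n x = Re (Tr x) / 2 ^ n"

lemma Tr_add: "Tr (x + y) = Tr x + Tr y"
proof -
  let ?K = "idx x \<union> idx y"
  have "Tr x = (\<Sum>r\<in>?K. entry x r r)" "Tr y = (\<Sum>r\<in>?K. entry y r r)"
    "Tr (x + y) = (\<Sum>r\<in>?K. entry (x + y) r r)"
    by (rule Tr_eq; auto simp: entry_outside)+
  then show ?thesis by (simp add: sum.distrib)
qed

lemma Tr_scaleR: "Tr (a *\<^sub>R x) = a *\<^sub>R Tr x"
proof -
  have "Tr (a *\<^sub>R x) = (\<Sum>r\<in>idx x. entry (a *\<^sub>R x) r r)"
    by (rule Tr_eq) (auto simp: entry_outside)
  then show ?thesis by (simp add: Tr_def scaleR_sum_right)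
qed

lemma Tr_mult: "Tr (x * y) = (\<Sum>r\<in>idx x \<union> idx y. \<Sum>k\<in>idx x \<union> idx y. entry x r k * entry y k r)"
proof -
  let ?K = "idx x \<union> idx y"
  have 1: "entry (x * y) r c = (\<Sum>k\<in>?K. entry x r k * entry y k c)" for r c
    by (rule entry_mult) (auto simp: entry_outside)
  have "Tr (x * y) = (\<Sum>r\<in>?K. entry (x * y) r r)"
    by (rule Tr_eq) (auto simp: 1 entry_outside intro!: sum.neutral)
  then show ?thesis by (simp add: 1)
qed

lemma Tr_commute: "Tr (x * y) = Tr (y * x)"
proof -
  have "Tr (x * y) = (\<Sum>k\<in>idx x \<union> idx y. \<Sum>r\<in>idx x \<union> idx y. entry x r k * entry y k r)"
    unfolding Tr_mult by (rule sum.swap)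
  also have "\<dots> = Tr (y * x)" unfolding Tr_mult Un_commute[of "idx y"] by (simp only: mult.commute)
  finally show ?thesis .
qed

lemma Tr_adj: "Tr (adj x) = cnj (Tr x)"
proof -
  have "Tr (adj x) = (\<Sum>r\<in>idx x. entry (adj x) r r)"
    by (rule Tr_eq) (auto simp: entry_outside)
  then show ?thesis by (simp add: Tr_def)
qed

lemma adj_mult: "adj (x * y) = adj y * adj x"
proof (rule fmat_eqI)
  fix r c
  let ?K = "idx x \<union> idx y"
  have "entry (x * y) c r = (\<Sum>k\<in>?K. entry x c k * entry y k r)"
    by (rule entry_mult) (auto simp: entry_outside)
  moreover have "entry (adj y * adj x) r c = (\<Sum>k\<in>?K. entry (adj y) r k * entry (adj x) k c)"
    by (rule entry_mult) (auto simp: entry_outside)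
  ultimately show "entry (adj (x * y)) r c = entry (adj y * adj x) r c"
    by (simp add: mult.commute)
qed

interpretation fmat: tracial_star_algebra adj "ntrace n" for n
proof
  fix x y :: fmat and c
  show "adj (x + y) = adj x + adj y" "adj (c *\<^sub>R x) = c *\<^sub>R adj x" "adj (adj x) = x"
    by (rule fmat_eqI; simp)+
  show "adj (x * y) = adj y * adj x" by (rule adj_mult)
  show "ntrace n (x + y) = ntrace n x + ntrace n y" "ntrace n (c *\<^sub>R x) = c * ntrace n x"
    by (simp_all add: ntrace_def Tr_add Tr_scaleR add_divide_distrib)
  show "ntrace n (x * y) = ntrace n (y * x)" by (simp add: ntrace_def Tr_commute)
  show "ntrace n (adj x) = ntrace n x" by (simp add: ntrace_def Tr_adj)
  show "0 \<le> ntrace n (adj x * x)"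
    unfolding ntrace_def Tr_mult
    by (auto intro!: sum_nonneg divide_nonneg_nonneg add_nonneg_nonneg)
qed

text \<open>Indices are read as bit strings. Conjugation by the Pauli matrix \<open>X\<close> at site \<open>j\<close> flips the \<open>j\<close>-th bit of
  both indices, and conjugation by \<open>Z\<close> multiplies an entry by \<open>-1\<close> if these bits differ.\<close>

definition flip_conj :: "nat \<Rightarrow> fmat \<Rightarrow> fmat" where
  "flip_conj j x = Fmat (\<lambda>r c. entry x (flip_bit j r) (flip_bit j c))"

definition bit_sign :: "nat \<Rightarrow> nat \<Rightarrow> complex" where
  "bit_sign j r = (if bit r j then - 1 else 1)"

definition sign_conj :: "nat \<Rightarrow> fmat \<Rightarrow> fmat" where
  "sign_conj j x = Fmat (\<lambda>r c. bit_sign j r * bit_sign j c * entry x r c)"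

lemma flip_bit_flip_bit [simp]: "flip_bit j (flip_bit j r) = (r :: nat)"
  by (rule bit_eqI) (auto simp: bit_simps)

lemma flip_bit_commute: "flip_bit i (flip_bit j r) = flip_bit j (flip_bit i (r :: nat))"
  by (rule bit_eqI) (auto simp: bit_simps)

lemma bit_sign_sq [simp]: "bit_sign j r * (bit_sign j r * z) = z" "bit_sign j r * bit_sign j r = 1"
  "cnj (bit_sign j r) = bit_sign j r"
  by (simp_all add: bit_sign_def)

lemma entry_flip_conj [simp]:
  "entry (flip_conj j x) r c = entry x (flip_bit j r) (flip_bit j c)"
  unfolding flip_conj_def
proof (subst entry_Fmat[of "flip_bit j ` idx x"])
  show "r \<in> flip_bit j ` idx x \<and> c \<in> flip_bit j ` idx x"
    if "entry x (flip_bit j r) (flip_bit j c) \<noteq> 0" for r c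
    using idx[OF that] by (metis flip_bit_flip_bit imageI)
qed simp_all

lemma entry_sign_conj [simp]:
  "entry (sign_conj j x) r c = bit_sign j r * bit_sign j c * entry x r c"
  unfolding sign_conj_def by (subst entry_Fmat[of "idx x"]) (auto simp: idx)

lemma sum_flip_bit:
  assumes "finite K"
  shows "(\<Sum>k\<in>flip_bit j ` K. f (flip_bit j k)) = (\<Sum>k\<in>K. f (k :: nat))"
  by (subst sum.reindex) (auto intro: inj_on_inverseI[of _ "flip_bit j"])

lemma involutive_aut_flip_conj: "fmat.involutive_aut n (flip_conj j)"
  unfolding fmat.involutive_aut_def
proof (intro conjI allI)
  fix x y :: fmat and a
  show "flip_conj j (x + y) = flip_conj j x + flip_conj j y"
    "flip_conj j (a *\<^sub>R x) = a *\<^sub>R flip_conj j x"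
    "flip_conj j (adj x) = adj (flip_conj j x)" "flip_conj j (flip_conj j x) = x"
    by (rule fmat_eqI; simp)+
  show "flip_conj j (x * y) = flip_conj j x * flip_conj j y"
  proof (rule fmat_eqI)
    fix r c
    have "entry (flip_conj j x * flip_conj j y) r c
      = (\<Sum>k\<in>flip_bit j ` idx x. entry (flip_conj j x) r k * entry (flip_conj j y) k c)"
      by (rule entry_mult) (auto, metis flip_bit_flip_bit idx(2) imageI)
    also have "\<dots> = (\<Sum>k\<in>idx x. entry x (flip_bit j r) k * entry y k (flip_bit j c))"
      by (simp add: sum_flip_bit[where f = "\<lambda>k. entry x (flip_bit j r) k * entry y k (flip_bit j c)"])
    also have "\<dots> = entry (x * y) (flip_bit j r) (flip_bit j c)"
      by (rule entry_mult[symmetric]) (auto simp: entry_outside)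
    finally show "entry (flip_conj j (x * y)) r c = entry (flip_conj j x * flip_conj j y) r c" by simp
  qed
  have "Tr (flip_conj j x) = (\<Sum>k\<in>flip_bit j ` idx x. entry (flip_conj j x) k k)"
    by (rule Tr_eq) (auto, metis flip_bit_flip_bit idx(2) imageI)
  also have "\<dots> = Tr x"
    by (simp add: Tr_def sum_flip_bit[where f = "\<lambda>k. entry x k k"])
  finally show "ntrace n (flip_conj j x) = ntrace n x" by (simp add: ntrace_def)
qed

lemma involutive_aut_sign_conj: "fmat.involutive_aut n (sign_conj j)"
  unfolding fmat.involutive_aut_def
proof (intro conjI allI)
  fix x y :: fmat and a
  show "sign_conj j (x + y) = sign_conj j x + sign_conj j y"
    "sign_conj j (a *\<^sub>R x) = a *\<^sub>R sign_conj j x"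
    "sign_conj j (adj x) = adj (sign_conj j x)" "sign_conj j (sign_conj j x) = x"
    by (rule fmat_eqI; simp add: algebra_simps)+
  show "sign_conj j (x * y) = sign_conj j x * sign_conj j y"
  proof (rule fmat_eqI)
    fix r c
    have "entry (sign_conj j x * sign_conj j y) r c
      = (\<Sum>k\<in>idx x. entry (sign_conj j x) r k * entry (sign_conj j y) k c)"
      by (rule entry_mult) (auto simp: entry_outside)
    also have "\<dots> = (\<Sum>k\<in>idx x. bit_sign j r * bit_sign j c * (entry x r k * entry y k c))"
      by (intro sum.cong refl) (simp add: mult_ac)
    also have "\<dots> = bit_sign j r * bit_sign j c * entry (x * y) r c"
      by (subst entry_mult[of "idx x"]) (auto simp: sum_distrib_left entry_outside)
    finally show "entry (sign_conj j (x * y)) r c = entry (sign_conj j x * sign_conj j y) r c" by simp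
  qed
  have "Tr (sign_conj j x) = (\<Sum>k\<in>idx x. entry (sign_conj j x) k k)"
    by (rule Tr_eq) (auto simp: entry_outside)
  then show "ntrace n (sign_conj j x) = ntrace n x" by (simp add: ntrace_def Tr_def)
qed

definition unit_of :: "nat \<Rightarrow> fmat" where
  "unit_of N = Fmat (\<lambda>r c. if r = c \<and> r < N then 1 else 0)"

lemma entry_unit_of [simp]: "entry (unit_of N) r c = (if r = c \<and> r < N then 1 else 0)"
  unfolding unit_of_def by (subst entry_Fmat[of "{..<N}"]) (auto split: if_splits)

lemma entry_mult_unit_of: "entry (x * unit_of N) r c = (if c < N then entry x r c else 0)"
  by (subst entry_mult[of "{c}"]) auto

lemma bit_less: "bit (r :: nat) j \<Longrightarrow> r < 2 ^ n \<Longrightarrow> j < n"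
proof (rule ccontr)
  assume "bit r j" "r < 2 ^ n" "\<not> j < n"
  then have "r < 2 ^ j" by (metis linorder_not_less order_less_le_trans one_le_numeral power_increasing)
  with \<open>bit r j\<close> show False by (simp add: bit_iff_odd)
qed

lemma less_iff_bits: "(r :: nat) < 2 ^ n \<longleftrightarrow> (\<forall>j. bit r j \<longrightarrow> j < n)"
proof
  assume "\<forall>j. bit r j \<longrightarrow> j < n"
  then have "take_bit n r = r" by (intro bit_eqI) (auto simp: bit_simps)
  then show "r < 2 ^ n" by (metis take_bit_nat_less_exp)
qed (auto intro: bit_less)

lemma flip_bit_less: "j < n \<Longrightarrow> flip_bit j (r :: nat) < 2 ^ n \<longleftrightarrow> r < 2 ^ n"
  unfolding less_iff_bits by (auto simp: bit_simps)

lemma flip_bit_eq_iff [simp]: "flip_bit j r = flip_bit j (c :: nat) \<longleftrightarrow> r = c"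
  by (metis flip_bit_flip_bit)

lemma flip_bit_of_set: "bit (r :: nat) j \<Longrightarrow> r = flip_bit j r + 2 ^ j"
proof -
  assume j: "bit r j"
  have "r = set_bit j (flip_bit j r)" by (rule bit_eqI) (use j in \<open>auto simp: bit_simps\<close>)
  then show ?thesis using j by (simp add: set_bit_eq bit_simps)
qed

lemma flip_sign_commute: "flip_conj i (sign_conj j x) = sign_conj j (flip_conj i x)"
  by (rule fmat_eqI) (auto simp: bit_sign_def bit_simps)

text \<open>The signs kill every entry off the diagonal, since two different indices differ in some bit; the flips make the
  diagonal constant, since every index can be reduced to 0 by clearing one bit after another.\<close>

lemma flip_sign_ergodic:
  assumes h: "adj h = h" "h * unit_of (2 ^ n) = h"
    and flip: "\<And>j. j < n \<Longrightarrow> flip_conj j h = h" and sign: "\<And>j. j < n \<Longrightarrow> sign_conj j h = h"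
  shows "\<exists>c. h = c *\<^sub>R unit_of (2 ^ n)"
proof
  have herm: "entry h r c = cnj (entry h c r)" for r c
    using arg_cong[OF h(1), of "\<lambda>x. entry x r c"] by simp
  have col: "entry h r c = 0" if "\<not> c < 2 ^ n" for r c
    using arg_cong[OF h(2), of "\<lambda>x. entry x r c"] that by (simp add: entry_mult_unit_of)
  have row: "entry h r c = 0" if "\<not> r < 2 ^ n" for r c
    using herm[of r c] col[OF that, of c] by simp
  have off: "entry h r c = 0" if "r \<noteq> c" for r c
  proof (cases "r < 2 ^ n \<and> c < 2 ^ n")
    case True
    obtain j where j: "bit r j \<noteq> bit c j" using \<open>r \<noteq> c\<close> by (metis bit_eqI)
    with True have "j < n" by (metis bit_less)
    with arg_cong[OF sign, of j "\<lambda>x. entry x r c"] j show ?thesis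
      by (auto simp: bit_sign_def split: if_splits)
  qed (use row col in auto)
  have diag: "r < 2 ^ n \<Longrightarrow> entry h r r = entry h 0 0" for r
  proof (induction r rule: less_induct)
    case (less r)
    show ?case
    proof (cases "r = 0")
      case False
      then obtain j where j: "bit r j" using bit_eq_iff[of r 0] by auto
      with less have "j < n" by (metis bit_less)
      have "flip_bit j r < r"
        using flip_bit_of_set[OF j] zero_less_power[of "2::nat" j] by linarith
      then have "entry h (flip_bit j r) (flip_bit j r) = entry h 0 0"
        by (rule less.IH) (use \<open>flip_bit j r < r\<close> less.prems in simp)
      then show ?thesis
        using entry_flip_conj[of j h r r] unfolding flip[OF \<open>j < n\<close>] by (rule trans[rotated])
    qed simp
  qed
  show "h = Re (entry h 0 0) *\<^sub>R unit_of (2 ^ n)"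
  proof (rule fmat_eqI)
    fix r c
    show "entry h r c = entry (Re (entry h 0 0) *\<^sub>R unit_of (2 ^ n)) r c"
      using diag[of r] off[of r c] row[of r c] herm[of 0 0]
      by (auto simp: complex_eq_iff)
  qed
qed

lemma unit_of_simps [simp]: "adj (unit_of N) = unit_of N" "unit_of N * unit_of N = unit_of N"
  by (rule fmat_eqI; simp add: entry_mult_unit_of)+

lemma ntrace_unit_of [simp]: "ntrace n (unit_of (2 ^ n)) = 1"
proof -
  have "Tr (unit_of (2 ^ n)) = (\<Sum>r<2 ^ n. entry (unit_of (2 ^ n)) r r)"
    by (rule Tr_eq) auto
  then show ?thesis by (simp add: ntrace_def)
qed

interpretation cube: qubit_system adj "ntrace n" "unit_of (2 ^ n)" n flip_conj sign_conj for n
proof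
  show "flip_conj j (unit_of (2 ^ n)) = unit_of (2 ^ n)" if "j < n" for j
    by (rule fmat_eqI) (simp add: flip_bit_less that)
  show "sign_conj j (unit_of (2 ^ n)) = unit_of (2 ^ n)" for j
    by (rule fmat_eqI) simp
  show "flip_conj i (flip_conj j x) = flip_conj j (flip_conj i x)" for i j x
    by (rule fmat_eqI) (simp add: flip_bit_commute)
  show "sign_conj i (sign_conj j x) = sign_conj j (sign_conj i x)" for i j x
    by (rule fmat_eqI) (simp add: mult_ac)
qed (auto simp: involutive_aut_flip_conj involutive_aut_sign_conj flip_sign_commute
    intro: flip_sign_ergodic)

section \<open>Diagonalization of Hermitian matrices\<close>

lemma adjoint_carrier [simp]: "A \<in> carrier_mat n m \<Longrightarrow> mat_adjoint A \<in> carrier_mat m n"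
  by (auto simp: mat_adjoint_def)

lemma adjoint_dim [simp]: "dim_row (mat_adjoint A) = dim_col A" "dim_col (mat_adjoint A) = dim_row A"
  by (auto simp: mat_adjoint_def)

lemma adjoint_index [simp]:
  fixes A :: "complex mat"
  shows "i < dim_col A \<Longrightarrow> j < dim_row A \<Longrightarrow> mat_adjoint A $$ (i, j) = cnj (A $$ (j, i))"
  by (simp add: mat_adjoint_def mat_of_rows_def conjugate_complex_def)

lemma adjoint_adjoint [simp]: "mat_adjoint (mat_adjoint A) = (A :: complex mat)"
  by (rule eq_matI) auto

lemma adjoint_mult:
  fixes A B :: "complex mat"
  assumes "A \<in> carrier_mat n m" "B \<in> carrier_mat m k"
  shows "mat_adjoint (A * B) = mat_adjoint B * mat_adjoint A"
  using assms by (intro eq_matI) (auto simp: scalar_prod_def mult.commute intro!: sum.cong)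

lemma adjoint_diag: "mat_adjoint (mat_diag n f) = mat_diag n (\<lambda>i. cnj (f i))"
  by (rule eq_matI) (auto simp: mat_diag_def)

lemma adjoint_four_block:
  fixes A :: "complex mat"
  assumes "A \<in> carrier_mat n1 m1" "B \<in> carrier_mat n1 m2" "C \<in> carrier_mat n2 m1" "D \<in> carrier_mat n2 m2"
  shows "mat_adjoint (four_block_mat A B C D)
    = four_block_mat (mat_adjoint A) (mat_adjoint C) (mat_adjoint B) (mat_adjoint D)"
  using assms by (intro eq_matI) (auto simp: four_block_mat_def Let_def)

lemma unitary_mat_mult:
  assumes "unitary_mat n U" "unitary_mat n V"
  shows "unitary_mat n (U * V)"
proof -
  have c: "U \<in> carrier_mat n n" "V \<in> carrier_mat n n"
    "mat_adjoint U \<in> carrier_mat n n" "mat_adjoint V \<in> carrier_mat n n"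
    using assms by (auto simp: unitary_mat_def)
  have "mat_adjoint V * mat_adjoint U * (U * V) = mat_adjoint V * (mat_adjoint U * U) * V"
    using c by (simp add: assoc_mult_mat[of _ n n _ n _ n] mult_carrier_mat[of _ n n _ n])
  moreover have "U * V * (mat_adjoint V * mat_adjoint U) = U * (V * mat_adjoint V) * mat_adjoint U"
    using c by (simp add: assoc_mult_mat[of _ n n _ n _ n] mult_carrier_mat[of _ n n _ n])
  ultimately show ?thesis
    using assms c unfolding unitary_mat_def by (simp add: adjoint_mult[OF c(1,2)])
qed

text \<open>Complete \<open>v\<close> to a basis, orthogonalize, and normalize the columns. The Gram--Schmidt process leaves the first
  vector unchanged.\<close>

lemma unitary_first_column:
  fixes v :: "complex vec"
  assumes v: "v \<in> carrier_vec n" "v \<noteq> 0\<^sub>v n"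
  obtains W c where "unitary_mat n W" "col W 0 = c \<cdot>\<^sub>v v"
proof -
  interpret cof_vec_space n "TYPE(complex)" .
  define b where "b = basis_completion v"
  define ws where "ws = gram_schmidt n b"
  note b = basis_completion[OF v, folded b_def]
  have n: "n > 0" using v by (cases n) auto
  obtain vs where bv: "b = v # vs" using b(6,7) n by (cases b) auto
  have ws: "corthogonal ws" "set ws \<subseteq> carrier_vec n" "length ws = n"
    using gram_schmidt_result[OF b(2,4,5) ws_def] b(6) by auto
  have hd: "ws ! 0 = v"
    using gram_schmidt_hd[OF v(1), of vs] ws(3) n hd_conv_nth[of ws] unfolding ws_def bv by force
  define g where "g i = complex_of_real (1 / sqrt (Re (ws ! i \<bullet>c ws ! i)))" for i
  have g: "cnj (g i) = g i" for i by (simp add: g_def)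
  define W where "W = mat n n (\<lambda>(r, i). g i * (ws ! i $ r))"
  have W: "W \<in> carrier_mat n n" by (simp add: W_def)
  have wsn: "ws ! i \<in> carrier_vec n" if "i < n" for i using ws that by auto
  have WW: "mat_adjoint W * W = 1\<^sub>m n"
  proof (rule eq_matI)
    fix i j assume "i < dim_row (1\<^sub>m n)" "j < dim_col (1\<^sub>m n)"
    then have ij: "i < n" "j < n" by auto
    have "(mat_adjoint W * W) $$ (i, j) = (\<Sum>r<n. cnj (W $$ (r, i)) * W $$ (r, j))"
      using ij W by (simp add: scalar_prod_def atLeast0LessThan)
    also have "\<dots> = g i * g j * (ws ! j \<bullet>c ws ! i)"
      using ij wsn[OF ij(1)] wsn[OF ij(2)]
      by (simp add: W_def scalar_prod_def sum_distrib_left g atLeast0LessThan mult_ac)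
    also have "\<dots> = (if i = j then 1 else 0)"
    proof (cases "i = j")
      case True
      have "ws ! i \<bullet>c ws ! i > 0"
        using corthogonalD[OF ws(1), of i i] ij ws(3) wsn[OF ij(1)] conjugate_square_greater_0_vec
          conjugate_square_eq_0_vec by (metis)
      then have "Re (ws ! i \<bullet>c ws ! i) > 0" "Im (ws ! i \<bullet>c ws ! i) = 0"
        by (auto simp: less_complex_def)
      then have "ws ! i \<bullet>c ws ! i = complex_of_real (Re (ws ! i \<bullet>c ws ! i))" "0 < Re (ws ! i \<bullet>c ws ! i)"
        by (auto simp: complex_eq_iff)
      then have "g i * g i * (ws ! i \<bullet>c ws ! i) = complex_of_real (1 / q * q)" if "q = Re (ws ! i \<bullet>c ws ! i)" for q
        unfolding g_def using that by (metis real_sqrt_mult_self abs_of_pos of_real_mult times_divide_times_eq mult_1)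
      then have "g i * g i * (ws ! i \<bullet>c ws ! i) = 1"
        using \<open>0 < Re (ws ! i \<bullet>c ws ! i)\<close> by simp
      then show ?thesis using True by simp
    next
      case False
      then show ?thesis using corthogonalD[OF ws(1), of j i] ij ws(3) by auto
    qed
    finally show "(mat_adjoint W * W) $$ (i, j) = 1\<^sub>m n $$ (i, j)" using ij by simp
  qed (use W in auto)
  then have "W * mat_adjoint W = 1\<^sub>m n"
    using mat_mult_left_right_inverse[of "mat_adjoint W" n W] W by simp
  with WW W have "unitary_mat n W" by (simp add: unitary_mat_def)
  moreover have "col W 0 = g 0 \<cdot>\<^sub>v v"
    using n hd v(1) by (intro eq_vecI) (auto simp: W_def)
  ultimately show ?thesis by (rule that)
qed

text \<open>By deflation: in an orthonormal basis that starts with an eigenvector, the first column of the Hermitian matrix is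
  a multiple of the first unit vector, and by symmetry so is the first row. The remaining block is Hermitian.\<close>

lemma hermitian_diagonalization:
  assumes "A \<in> carrier_mat n n" "mat_adjoint A = A"
  shows "\<exists>U d. unitary_mat n U \<and> A = U * mat_diag n (\<lambda>i. complex_of_real (d i)) * mat_adjoint U"
  using assms
proof (induction n arbitrary: A)
  case 0
  then show ?case
    by (intro exI[of _ "1\<^sub>m 0"] exI[of _ "\<lambda>_. 0"]) (auto simp: unitary_mat_def)
next
  case (Suc m)
  let ?n = "Suc m"
  note A = Suc.prems
  obtain e where "e \<in> spectrum A" using spectrum_non_empty[OF A(1)] by auto
  then obtain v where v: "v \<in> carrier_vec ?n" "v \<noteq> 0\<^sub>v ?n" "A *\<^sub>v v = e \<cdot>\<^sub>v v"
    using A(1) by (auto simp: spectrum_def eigenvalue_def eigenvector_def)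
  obtain W c where W: "unitary_mat ?n W" "col W 0 = c \<cdot>\<^sub>v v"
    using unitary_first_column[OF v(1,2)] by blast
  have Wc: "W \<in> carrier_mat ?n ?n" "mat_adjoint W \<in> carrier_mat ?n ?n"
    and W1: "mat_adjoint W * W = 1\<^sub>m ?n" "W * mat_adjoint W = 1\<^sub>m ?n"
    using W by (auto simp: unitary_mat_def)
  note as = assoc_mult_mat[of _ ?n ?n _ ?n _ ?n] and [simp] = mult_carrier_mat[of _ ?n ?n _ ?n]
  define B where "B = mat_adjoint W * A * W"
  have B: "B \<in> carrier_mat ?n ?n" unfolding B_def using A Wc by (intro mult_carrier_mat[of _ _ ?n])
  have "mat_adjoint B = B"
    unfolding B_def using A Wc by (simp add: adjoint_mult[of _ ?n ?n _ ?n] as)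
  then have Bherm: "cnj (B $$ (j, i)) = B $$ (i, j)" if "i < ?n" "j < ?n" for i j
    using that B adjoint_index[of i B j] by auto
  have AW: "W * B * mat_adjoint W = A"
  proof -
    have "W * B * mat_adjoint W = (W * mat_adjoint W) * A * (W * mat_adjoint W)"
      unfolding B_def using A Wc by (simp add: as)
    then show ?thesis using A W1 by simp
  qed
  have "col B 0 = e \<cdot>\<^sub>v unit_vec ?n 0"
  proof -
    have "col B 0 = (mat_adjoint W * A) *\<^sub>v col W 0"
      unfolding B_def using Wc A by (intro col_mult2[of _ ?n ?n _ ?n]) auto
    also have "\<dots> = mat_adjoint W *\<^sub>v (A *\<^sub>v (c \<cdot>\<^sub>v v))"
      using Wc A v W by (simp add: assoc_mult_mat_vec[of _ ?n ?n _ ?n])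
    also have "A *\<^sub>v (c \<cdot>\<^sub>v v) = e \<cdot>\<^sub>v col W 0"
      using A v by (simp add: W mult_mat_vec[of _ ?n ?n] smult_smult_assoc mult.commute)
    also have "mat_adjoint W *\<^sub>v (e \<cdot>\<^sub>v col W 0) = e \<cdot>\<^sub>v col (mat_adjoint W * W) 0"
      using Wc by (subst col_mult2[of _ ?n ?n _ ?n]) (auto simp: mult_mat_vec[of _ ?n ?n])
    finally show ?thesis by (simp add: W1)
  qed
  then have B0: "B $$ (i, 0) = (if i = 0 then e else 0)" if "i < ?n" for i
  proof -
    have "B $$ (i, 0) = col B 0 $ i" using that B by simp
    then show ?thesis using that \<open>col B 0 = _\<close> by (simp add: unit_vec_def)
  qed
  have e: "e = complex_of_real (Re e)"
    using Bherm[of 0 0] B0[of 0] by (auto simp: complex_eq_iff)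
  define C where "C = mat m m (\<lambda>(i, j). B $$ (Suc i, Suc j))"
  have C: "C \<in> carrier_mat m m" by (simp add: C_def)
  have "mat_adjoint C = C"
    by (rule eq_matI) (auto simp: C_def Bherm)
  then obtain U d where U: "unitary_mat m U"
    and Cd: "C = U * mat_diag m (\<lambda>i. complex_of_real (d i)) * mat_adjoint U"
    using Suc.IH[OF C] by blast
  have Uc: "U \<in> carrier_mat m m" "mat_adjoint U \<in> carrier_mat m m"
    and U1: "mat_adjoint U * U = 1\<^sub>m m" "U * mat_adjoint U = 1\<^sub>m m"
    using U by (auto simp: unitary_mat_def)
  let ?blk = "\<lambda>X Y. four_block_mat X (0\<^sub>m 1 m) (0\<^sub>m m 1) Y"
  define V where "V = ?blk (1\<^sub>m 1) U"
  have Vadj: "mat_adjoint V = ?blk (1\<^sub>m 1) (mat_adjoint U)"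
  proof -
    have "mat_adjoint (0\<^sub>m a b :: complex mat) = 0\<^sub>m b a" for a b by (rule eq_matI) auto
    then show ?thesis unfolding V_def using Uc by (subst adjoint_four_block) auto
  qed
  have blk_mult: "?blk X Y * ?blk X' Y' = ?blk (X * X') (Y * Y')"
    if "X \<in> carrier_mat 1 1" "X' \<in> carrier_mat 1 1" "Y \<in> carrier_mat m m" "Y' \<in> carrier_mat m m"
    for X X' Y Y' :: "complex mat"
    using that by (subst mult_four_block_mat[of _ 1 1 _ m _ m _ _ 1 _ m]) auto
  have blk_one: "?blk (1\<^sub>m 1) (1\<^sub>m m) = (1\<^sub>m ?n :: complex mat)"
    by (rule eq_matI) (auto simp: four_block_mat_def Let_def)
  have V: "unitary_mat ?n V"
    unfolding unitary_mat_def Vadj unfolding V_def using Uc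
    by (simp add: blk_mult U1 blk_one del: One_nat_def) (simp add: four_block_mat_def Let_def)
  let ?d = "\<lambda>i. case i of 0 \<Rightarrow> Re e | Suc j \<Rightarrow> d j"
  let ?D = "mat_diag ?n (\<lambda>i. complex_of_real (?d i))"
  let ?e = "mat_diag 1 (\<lambda>_. e)"
  have D: "?D = ?blk ?e (mat_diag m (\<lambda>i. complex_of_real (d i)))"
    using e by (intro eq_matI) (auto simp: four_block_mat_def Let_def mat_diag_def split: nat.splits)
  have "V * ?D * mat_adjoint V = ?blk ?e C"
    unfolding Vadj D unfolding V_def Cd using Uc
    by (simp add: blk_mult left_mult_one_mat[of _ 1 1] right_mult_one_mat[of _ 1 1] mult_carrier_mat[of _ m m _ m] del: One_nat_def)
  also have "\<dots> = B"
  proof (rule eq_matI)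
    fix i j assume "i < dim_row B" "j < dim_col B"
    then have ij: "i < ?n" "j < ?n" using B by auto
    have "B $$ (0, j) = cnj (B $$ (j, 0))" using Bherm[of 0 j] ij by simp
    then show "?blk ?e C $$ (i, j) = B $$ (i, j)"
      using ij B0[of i] B0[of j]
      by (cases i; cases j) (auto simp: four_block_mat_def Let_def mat_diag_def C_def)
  qed (use B C in \<open>auto simp: mat_diag_def\<close>)
  finally have VB: "V * ?D * mat_adjoint V = B" .
  have Vc: "V \<in> carrier_mat ?n ?n" "mat_adjoint V \<in> carrier_mat ?n ?n"
    using V by (auto simp: unitary_mat_def)
  have "A = W * (V * ?D * mat_adjoint V) * mat_adjoint W" by (simp add: VB AW)
  also have "\<dots> = (W * V) * ?D * mat_adjoint (W * V)"
    using Vc Wc by (simp add: adjoint_mult[of _ ?n ?n _ ?n] as)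
  finally show ?case using unitary_mat_mult[OF W(1) V] by blast
qed

section \<open>From block matrices to the qubit system\<close>

text \<open>The identification of \<open>N \<times> N\<close> matrices with the upper left corner of size \<open>N\<close>.\<close>

definition emb :: "nat \<Rightarrow> complex mat \<Rightarrow> fmat" where
  "emb N A = Fmat (\<lambda>r c. if r < N \<and> c < N then A $$ (r, c) else 0)"

lemma entry_emb [simp]: "entry (emb N A) r c = (if r < N \<and> c < N then A $$ (r, c) else 0)"
  unfolding emb_def by (subst entry_Fmat[of "{..<N}"]) (auto split: if_splits)

lemma emb_mult:
  assumes "A \<in> carrier_mat N N" "B \<in> carrier_mat N N"
  shows "emb N (A * B) = emb N A * emb N B"
proof (rule fmat_eqI)
  fix r c
  have "entry (emb N A * emb N B) r c = (\<Sum>k<N. entry (emb N A) r k * entry (emb N B) k c)"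
    by (rule entry_mult) auto
  then show "entry (emb N (A * B)) r c = entry (emb N A * emb N B) r c"
    using assms by (auto simp: scalar_prod_def atLeast0LessThan intro!: sum.cong)
qed

lemma emb_adjoint:
  assumes "A \<in> carrier_mat N N"
  shows "emb N (mat_adjoint A) = adj (emb N A)"
  by (rule fmat_eqI) (use assms in auto)

lemma emb_add:
  assumes "A \<in> carrier_mat N N" "B \<in> carrier_mat N N"
  shows "emb N (A + B) = emb N A + emb N B"
  by (rule fmat_eqI) (use assms in auto)

lemma emb_zero [simp]: "emb N (0\<^sub>m N N) = 0"
  by (rule fmat_eqI) auto

lemma emb_one [simp]: "emb N (1\<^sub>m N) = unit_of N"
  by (rule fmat_eqI) auto

lemma emb_unit_of [simp]: "emb N A * unit_of N = emb N A"
  by (rule fmat_eqI) (auto simp: entry_mult_unit_of)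

lemma ntrace_emb:
  assumes "A \<in> carrier_mat (2 ^ n) (2 ^ n)"
  shows "ntrace n (emb (2 ^ n) A) = Re (ntr A)"
proof -
  have "Tr (emb (2 ^ n) A) = (\<Sum>r<2 ^ n. entry (emb (2 ^ n) A) r r)"
    by (rule Tr_eq) auto
  moreover have "Re (z / 2 ^ n) = Re z / 2 ^ n" for z
    by (metis Re_divide_of_real of_real_numeral of_real_power)
  ultimately show ?thesis using assms by (simp add: ntrace_def ntr_def)
qed

lemma finsum_mat:
  assumes "finite J" "\<And>j. j \<in> J \<Longrightarrow> f j \<in> carrier_mat N N"
  shows "(\<Oplus>\<^bsub>module_mat TYPE(complex) N N\<^esub>j\<in>J. f j) \<in> carrier_mat N N \<and>
    emb N (\<Oplus>\<^bsub>module_mat TYPE(complex) N N\<^esub>j\<in>J. f j) = (\<Sum>j\<in>J. emb N (f j))"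
  using assms
proof (induction J)
  case empty
  interpret abelian_group "module_mat TYPE(complex) N N" by (rule abelian_group_mat)
  show ?case using finsum_empty by (simp add: module_mat_simps)
next
  case (insert j J)
  interpret abelian_group "module_mat TYPE(complex) N N" by (rule abelian_group_mat)
  have "(\<Oplus>\<^bsub>module_mat TYPE(complex) N N\<^esub>j\<in>insert j J. f j)
      = f j + (\<Oplus>\<^bsub>module_mat TYPE(complex) N N\<^esub>j\<in>J. f j)"
    using insert by (subst finsum_insert) (auto simp: module_mat_simps)
  then show ?case using insert by (simp add: emb_add)
qed

lemma tensor_map_id_left:
  assumes \<Psi>: "\<And>k l. k < b \<Longrightarrow> l < b \<Longrightarrow> \<Psi> (munit b k l) \<in> carrier_mat b b"
    and rc: "r < a * b" "c < a * b"
  shows "tensor_map a b id \<Psi> X $$ (r, c) = (\<Sum>k<b. \<Sum>l<b.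
    X $$ (r div b * b + k, c div b * b + l) * \<Psi> (munit b k l) $$ (r mod b, c mod b))"
proof -
  have q: "r div b < a" "c div b < a" using rc by (auto simp: less_mult_imp_div_less)
  have "tensor_map a b id \<Psi> X $$ (r, c) = (\<Sum>i<a. \<Sum>j<a. \<Sum>k<b. \<Sum>l<b.
      X $$ (i * b + k, j * b + l) *
        ((if r div b = i \<and> c div b = j then 1 else 0) * \<Psi> (munit b k l) $$ (r mod b, c mod b)))"
    using rc q unfolding tensor_map_def
    by (auto simp: kron_def munit_def carrier_matD[OF \<Psi>, unfolded munit_def] intro!: sum.cong)
  also have "\<dots> = (\<Sum>i<a. \<Sum>j<a. if j = c div b then (if i = r div b then (\<Sum>k<b. \<Sum>l<b.
      X $$ (i * b + k, j * b + l) * \<Psi> (munit b k l) $$ (r mod b, c mod b)) else 0) else 0)"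
    by (intro sum.cong refl) auto
  also have "\<dots> = (\<Sum>k<b. \<Sum>l<b.
    X $$ (r div b * b + k, c div b * b + l) * \<Psi> (munit b k l) $$ (r mod b, c mod b))"
    using q by (simp add: sum.delta)
  finally show ?thesis .
qed

lemma tensor_map_id_right:
  assumes \<Phi>: "\<And>k l. k < a \<Longrightarrow> l < a \<Longrightarrow> \<Phi> (munit a k l) \<in> carrier_mat a a"
    and rc: "r < a * b" "c < a * b"
  shows "tensor_map a b \<Phi> id X $$ (r, c) = (\<Sum>i<a. \<Sum>j<a.
    X $$ (i * b + r mod b, j * b + c mod b) * \<Phi> (munit a i j) $$ (r div b, c div b))"
proof -
  have b: "b > 0" using rc by (auto intro: gr0I)
  have q: "r div b < a" "c div b < a" "r mod b < b" "c mod b < b"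
    using rc b by (auto simp: less_mult_imp_div_less)
  have "tensor_map a b \<Phi> id X $$ (r, c) = (\<Sum>i<a. \<Sum>j<a. \<Sum>k<b. \<Sum>l<b.
      X $$ (i * b + k, j * b + l) *
        (\<Phi> (munit a i j) $$ (r div b, c div b) * (if r mod b = k \<and> c mod b = l then 1 else 0)))"
    using rc q unfolding tensor_map_def
    by (auto simp: kron_def munit_def carrier_matD[OF \<Phi>, unfolded munit_def] intro!: sum.cong)
  also have "\<dots> = (\<Sum>i<a. \<Sum>j<a. \<Sum>k<b. \<Sum>l<b. if l = c mod b then (if k = r mod b then
      X $$ (i * b + k, j * b + l) * \<Phi> (munit a i j) $$ (r div b, c div b) else 0) else 0)"
    by (intro sum.cong refl) auto
  also have "\<dots> = (\<Sum>i<a. \<Sum>j<a.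
      X $$ (i * b + r mod b, j * b + c mod b) * \<Phi> (munit a i j) $$ (r div b, c div b))"
    using q by (simp add: sum.delta)
  finally show ?thesis .
qed

lemma D_map_munit:
  assumes "i < 2" "j < 2" "s < 2" "t < 2"
  shows "D_map (munit 2 i j) $$ (s, t)
    = (if s = i \<and> t = j then 1 else 0) - (if i = j \<and> s = t then 1 / 2 else 0)"
  using assms by (auto simp: D_map_def munit_def ntr_def less_2_cases_iff numeral_2_eq_2)

lemma D_map_carrier: "D_map (munit 2 i j) \<in> carrier_mat 2 2"
  unfolding D_map_def by (rule minus_carrier_mat) simp

text \<open>For \<open>q\<close> a power of two, the index \<open>r\<close> is split into the part above the bit of weight \<open>q\<close>, that bit, and
  the part below. This is the decomposition of an index along the tensor product of three factors.\<close>

lemma base_digits: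
  fixes q :: nat
  shows "r = r div (2 * q) * (2 * q) + (r div q mod 2 * q + r mod q)"
proof -
  have "r mod (q * 2) = q * (r div q mod 2) + r mod q" by (rule mod_mult2_eq)
  then show ?thesis using div_mult_mod_eq[of r "2 * q"] by (simp add: mult.commute)
qed

lemma flip_bit_digits:
  fixes r :: nat
  shows "flip_bit p r = r div (2 * 2 ^ p) * (2 * 2 ^ p) + ((1 - r div 2 ^ p mod 2) * 2 ^ p + r mod 2 ^ p)"
proof (cases "bit r p")
  case True
  then have "r div 2 ^ p mod 2 = 1" by (simp add: bit_iff_odd odd_iff_mod_2_eq_one)
  then show ?thesis using flip_bit_of_set[OF True] base_digits[of r "2 ^ p"] by simp
next
  case False
  then have "r div 2 ^ p mod 2 = 0" by (simp add: bit_iff_odd even_iff_mod_2_eq_zero)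
  moreover have "flip_bit p r = r + 2 ^ p"
    using flip_bit_of_set[of "flip_bit p r" p] False by (simp add: bit_simps)
  ultimately show ?thesis using base_digits[of r "2 ^ p"] by simp
qed

lemma sum_swap4:
  "(\<Sum>k\<in>A. \<Sum>l\<in>B. \<Sum>i\<in>C. \<Sum>j\<in>D. f k l i j) = (\<Sum>i\<in>C. \<Sum>j\<in>D. \<Sum>k\<in>A. \<Sum>l\<in>B. f k l i j)"
proof -
  have "(\<Sum>k\<in>A. \<Sum>l\<in>B. \<Sum>i\<in>C. \<Sum>j\<in>D. f k l i j) = (\<Sum>k\<in>A. \<Sum>i\<in>C. \<Sum>j\<in>D. \<Sum>l\<in>B. f k l i j)"
    by (intro sum.cong refl, subst sum.swap, intro sum.cong refl sum.swap)
  also have "\<dots> = (\<Sum>i\<in>C. \<Sum>j\<in>D. \<Sum>k\<in>A. \<Sum>l\<in>B. f k l i j)"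
    by (subst sum.swap, intro sum.cong refl sum.swap)
  finally show ?thesis .
qed

text \<open>The site \<open>j\<close>, counted from the left of the tensor product, is the bit \<open>n - j\<close> of the index, because the
  leftmost factor carries the most significant bit. On that factor, subtracting the normalized trace affects the
  entries whose bits agree, and replaces each by its difference with the average over the two values of the bit.\<close>

lemma partial_d_entry:
  assumes j: "1 \<le> j" "j \<le> n" and rc: "r < 2 ^ n" "c < 2 ^ n"
  defines "p \<equiv> n - j"
  shows "partial_d n j X $$ (r, c) = X $$ (r, c)
    - (if bit r p = bit c p then (X $$ (r, c) + X $$ (flip_bit p r, flip_bit p c)) / 2 else 0)"
proof -
  let ?q = "2 ^ p :: nat"
  let ?b = "2 * ?q"
  have ab: "(2::nat) ^ (j - 1) * ?b = 2 ^ n"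
    using j by (simp only: p_def power_Suc[symmetric] power_add[symmetric]) simp
  define s where "s = r div ?q mod 2"
  define t where "t = c div ?q mod 2"
  define x where "x i j = X $$ (r div ?b * ?b + (i * ?q + r mod ?q), c div ?b * ?b + (j * ?q + c mod ?q))" for i j
  have st: "s < 2" "t < 2" by (simp_all add: s_def t_def)
  have dm: "r mod ?b div ?q = s" "c mod ?b div ?q = t" "r mod ?b mod ?q = r mod ?q" "c mod ?b mod ?q = c mod ?q"
    unfolding mult.commute[of 2 ?q] s_def t_def by (simp_all add: mod_mult2_eq)
  have lt: "i * ?q + m mod ?q < ?b" if "i < 2" for i m
    using that mod_less_divisor[of ?q m] by (auto simp: less_2_cases_iff simp del: mod_less_divisor)
  have "partial_d n j X $$ (r, c) = (\<Sum>k<?b. \<Sum>l<?b. X $$ (r div ?b * ?b + k, c div ?b * ?b + l) *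
      tensor_map 2 ?q D_map id (munit ?b k l) $$ (r mod ?b, c mod ?b))"
    unfolding partial_d_def p_def[symmetric] using rc ab
    by (intro tensor_map_id_left) (auto simp: tensor_map_def)
  also have "\<dots> = (\<Sum>k<?b. \<Sum>l<?b. X $$ (r div ?b * ?b + k, c div ?b * ?b + l) *
      (\<Sum>i<2. \<Sum>j<2. (if k = i * ?q + r mod ?q \<and> l = j * ?q + c mod ?q then 1 else 0) *
         D_map (munit 2 i j) $$ (s, t)))"
  proof (intro sum.cong refl arg_cong2[of _ _ _ _ "(*)"])
    fix k l
    have "tensor_map 2 ?q D_map id (munit ?b k l) $$ (r mod ?b, c mod ?b)
      = (\<Sum>i<2. \<Sum>j<2. munit ?b k l $$ (i * ?q + r mod ?b mod ?q, j * ?q + c mod ?b mod ?q) *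
          D_map (munit 2 i j) $$ (r mod ?b div ?q, c mod ?b div ?q))"
      by (rule tensor_map_id_right) (auto simp: D_map_carrier)
    then show "tensor_map 2 ?q D_map id (munit ?b k l) $$ (r mod ?b, c mod ?b)
      = (\<Sum>i<2. \<Sum>j<2. (if k = i * ?q + r mod ?q \<and> l = j * ?q + c mod ?q then 1 else 0) *
         D_map (munit 2 i j) $$ (s, t))"
      unfolding dm using lt by (auto simp: munit_def intro!: sum.cong)
  qed
  also have "\<dots> = (\<Sum>i<2. \<Sum>j<2. \<Sum>k<?b. \<Sum>l<?b. if l = j * ?q + c mod ?q then
      (if k = i * ?q + r mod ?q then X $$ (r div ?b * ?b + k, c div ?b * ?b + l) * D_map (munit 2 i j) $$ (s, t) else 0) else 0)"
    unfolding sum_distrib_left by (subst sum_swap4) (intro sum.cong refl; auto)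
  also have "\<dots> = (\<Sum>i<2. \<Sum>j<2. x i j * D_map (munit 2 i j) $$ (s, t))"
    using lt by (intro sum.cong refl) (simp add: sum.delta x_def)
  also have "\<dots> = (\<Sum>i<2. \<Sum>j<2. x i j *
      ((if s = i \<and> t = j then 1 else 0) - (if i = j \<and> s = t then 1 / 2 else 0)))"
    using st by (intro sum.cong refl) (simp add: D_map_munit)
  also have "\<dots> = x s t - (if s = t then (x s t + x (1 - s) (1 - t)) / 2 else 0)"
  proof -
    have "s = 0 \<or> s = 1" "t = 0 \<or> t = 1" using st by auto
    then show ?thesis by (elim disjE) (simp_all add: numeral_2_eq_2 field_simps)
  qed
  also have "x s t = X $$ (r, c)"
    unfolding x_def s_def t_def using base_digits[of r ?q] base_digits[of c ?q] by simp
  also have "x (1 - s) (1 - t) = X $$ (flip_bit p r, flip_bit p c)"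
    unfolding x_def s_def t_def flip_bit_digits by simp
  also have "s = t \<longleftrightarrow> bit r p = bit c p"
    unfolding s_def t_def by (auto simp: bit_iff_odd even_iff_mod_2_eq_zero odd_iff_mod_2_eq_one)
  finally show ?thesis .
qed

lemma emb_partial_d:
  assumes "1 \<le> j" "j \<le> n"
  shows "emb (2 ^ n) (partial_d n j T) = cube.d (n - j) (emb (2 ^ n) T)"
proof (rule fmat_eqI)
  fix r c
  let ?p = "n - j" and ?x = "emb (2 ^ n) T"
  have p: "?p < n" using assms by simp
  have "entry (cube.d ?p ?x) r c = entry ?x r c
      - (if bit r ?p = bit c ?p then (entry ?x r c + entry ?x (flip_bit ?p r) (flip_bit ?p c)) / 2 else 0)"
    by (simp add: cube.d_def cube.E_def cube.sign_part_def bit_sign_def bit_simps scaleR_conv_of_real)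
  then show "entry (emb (2 ^ n) (partial_d n j T)) r c = entry (cube.d ?p ?x) r c"
    using assms by (auto simp: partial_d_entry flip_bit_less[OF p])
qed

lemma emb_grad_sq:
  "emb (2 ^ n) (grad_sq n T)
    = (\<Sum>p<n. adj (cube.d p (emb (2 ^ n) T)) * cube.d p (emb (2 ^ n) T))"
  "grad_sq n T \<in> carrier_mat (2 ^ n) (2 ^ n)"
proof -
  let ?N = "2 ^ n :: nat" and ?f = "\<lambda>j. mat_adjoint (partial_d n j T) * partial_d n j T"
  have c: "partial_d n j T \<in> carrier_mat ?N ?N" if "j \<in> {1..n}" for j
    using that partial_d_carrier by auto
  have f: "?f j \<in> carrier_mat ?N ?N" if "j \<in> {1..n}" for j
    using c[OF that] by (auto intro: mult_carrier_mat)
  note sum = finsum_mat[of "{1..n}" ?f ?N, OF _ f]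
  show "grad_sq n T \<in> carrier_mat ?N ?N" unfolding grad_sq_def using sum by simp
  have "emb ?N (grad_sq n T) = (\<Sum>j\<in>{1..n}. emb ?N (?f j))"
    unfolding grad_sq_def using sum by simp
  also have "\<dots> = (\<Sum>j\<in>{1..n}. adj (cube.d (n - j) (emb ?N T)) * cube.d (n - j) (emb ?N T))"
    by (intro sum.cong refl)
      (simp add: emb_mult[OF adjoint_carrier[OF c] c] emb_adjoint[OF c] emb_partial_d)
  also have "\<dots> = (\<Sum>p<n. adj (cube.d p (emb ?N T)) * cube.d p (emb ?N T))"
    by (rule sum.reindex_bij_witness[of _ "\<lambda>p. n - p" "\<lambda>j. n - j"]) auto
  finally show "emb ?N (grad_sq n T) = (\<Sum>p<n. adj (cube.d p (emb ?N T)) * cube.d p (emb ?N T))" .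
qed

abbreviation dg :: "nat \<Rightarrow> (nat \<Rightarrow> real) \<Rightarrow> complex mat" where
  "dg n d \<equiv> mat_diag n (\<lambda>i. complex_of_real (d i))"

lemma unitary_conj_mult:
  assumes "unitary_mat n U"
  shows "U * dg n d * mat_adjoint U * (U * dg n d' * mat_adjoint U)
    = U * dg n (\<lambda>i. d i * d' i) * mat_adjoint U"
proof -
  have c: "U \<in> carrier_mat n n" "mat_adjoint U \<in> carrier_mat n n" "mat_adjoint U * U = 1\<^sub>m n"
    using assms by (auto simp: unitary_mat_def)
  note [simp] = mult_carrier_mat[of _ n n _ n] c(1,2) and as = assoc_mult_mat[of _ n n _ n _ n]
  have "U * dg n d * mat_adjoint U * (U * dg n d' * mat_adjoint U)
      = U * dg n d * (mat_adjoint U * U) * (dg n d' * mat_adjoint U)" by (simp add: as)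
  also have "\<dots> = U * (dg n d * dg n d') * mat_adjoint U" unfolding c(3) by (simp add: as left_mult_one_mat[of _ n n] right_mult_one_mat[of _ n n] del: mat_diag_diag)
  finally show ?thesis by simp
qed

lemma unitary_conj_carrier:
  "unitary_mat n U \<Longrightarrow> U * dg n d * mat_adjoint U \<in> carrier_mat n n"
  by (auto simp: unitary_mat_def)

lemma unitary_conj_adjoint:
  assumes "unitary_mat n U"
  shows "mat_adjoint (U * dg n d * mat_adjoint U) = U * dg n d * mat_adjoint U"
proof -
  have c: "U \<in> carrier_mat n n" "mat_adjoint U \<in> carrier_mat n n"
    using assms by (auto simp: unitary_mat_def)
  note [simp] = mult_carrier_mat[of _ n n _ n] c and as = assoc_mult_mat[of _ n n _ n _ n]
  show ?thesis by (simp add: adjoint_mult[of _ n n _ n] adjoint_diag as)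
qed

lemma mat_powr_unitary_conj:
  assumes "unitary_mat n U" "\<And>i. i < n \<Longrightarrow> 0 \<le> d i"
  shows "mat_powr (U * dg n d * mat_adjoint U) a = U * dg n (\<lambda>i. d i powr a) * mat_adjoint U"
  using assms unfolding mat_powr_rel_def by (intro mat_powr_eqI) (auto simp: mat_powr_rel_def)

lemma mat_diag_cong: "(\<And>i. i < n \<Longrightarrow> f i = g i) \<Longrightarrow> mat_diag n f = mat_diag n g"
  by (rule eq_matI) (auto simp: mat_diag_def)

text \<open>The square root \<open>S\<close> is positive semidefinite, so it is its own absolute value and its own first power.\<close>

lemma Lp_norm_1_sqrt:
  assumes U: "unitary_mat n U" and d: "\<And>i. i < n \<Longrightarrow> 0 \<le> d i"
  defines "A \<equiv> U * dg n d * mat_adjoint U" and "S \<equiv> U * dg n (\<lambda>i. sqrt (d i)) * mat_adjoint U"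
  assumes pos: "0 \<le> Re (ntr S)"
  shows "Lp_norm 1 (mat_powr A (1 / 2)) = Re (ntr S)"
proof -
  have root: "mat_powr A (1 / 2) = S"
    unfolding A_def S_def using d
    by (subst mat_powr_unitary_conj[OF U]) (auto intro!: arg_cong2[of _ _ _ _ "(*)"] mat_diag_cong simp: powr_half_sqrt)
  have "mat_adjoint S * S = A"
    unfolding S_def unitary_conj_adjoint[OF U] unitary_conj_mult[OF U] A_def
    using d by (auto intro!: arg_cong2[of _ _ _ _ "(*)"] mat_diag_cong simp flip: of_real_mult)
  then have "mat_abs S = S" by (simp add: mat_abs_def root)
  moreover have "mat_powr S 1 = S"
    unfolding S_def using d
    by (subst mat_powr_unitary_conj[OF U]) (auto intro!: arg_cong2[of _ _ _ _ "(*)"] mat_diag_cong)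
  ultimately show ?thesis using pos by (simp add: Lp_norm_def root)
qed

text \<open>The eigenvalues of a projection are 0 and 1, which are their own square roots.\<close>

lemma mat_abs_projection:
  assumes T: "is_projection N T"
  shows "mat_abs T = T"
proof -
  have Tc: "T \<in> carrier_mat N N" "mat_adjoint T = T" "T * T = T" using T by (auto simp: is_projection_def)
  obtain U d where U: "unitary_mat N U" and Td: "T = U * dg N d * mat_adjoint U"
    using hermitian_diagonalization[OF Tc(1,2)] by blast
  have c: "U \<in> carrier_mat N N" "mat_adjoint U \<in> carrier_mat N N" "mat_adjoint U * U = 1\<^sub>m N"
    using U by (auto simp: unitary_mat_def)
  note [simp] = mult_carrier_mat[of _ N N _ N] c(1,2) and as = assoc_mult_mat[of _ N N _ N _ N]
  have undo: "mat_adjoint U * (U * dg N f * mat_adjoint U) * U = dg N f" for f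
  proof -
    have "mat_adjoint U * (U * dg N f * mat_adjoint U) * U
      = (mat_adjoint U * U) * dg N f * (mat_adjoint U * U)" by (simp add: as)
    then show ?thesis unfolding c(3) by (simp add: left_mult_one_mat[of _ N N] right_mult_one_mat[of _ N N])
  qed
  have eq: "dg N (\<lambda>i. d i * d i) = dg N d"
    using Tc(3) undo[of "\<lambda>i. d i * d i"] undo[of d] unitary_conj_mult[OF U, of d d] by (simp add: Td[symmetric])
  have "d i * d i = d i" if "i < N" for i
  proof -
    have "dg N (\<lambda>i. d i * d i) $$ (i, i) = dg N d $$ (i, i)" by (rule arg_cong[OF eq])
    then show ?thesis using that unfolding mat_diag_def by (simp del: of_real_mult)
  qed
  then have d: "d i = 0 \<or> d i = 1" if "i < N" for i using that by force
  have "mat_powr T (1 / 2) = U * dg N (\<lambda>i. d i powr (1 / 2)) * mat_adjoint U"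
    unfolding Td using d by (intro mat_powr_unitary_conj[OF U]) force
  also have "dg N (\<lambda>i. d i powr (1 / 2)) = dg N d" using d by (intro mat_diag_cong) force
  finally show ?thesis by (simp add: mat_abs_def Tc Td[symmetric])
qed

lemma var_projection:
  assumes T: "is_projection (2 ^ n) T"
  shows "var T = ntrace n (emb (2 ^ n) T) - (ntrace n (emb (2 ^ n) T))\<^sup>2"
proof -
  have Tc: "T \<in> carrier_mat (2 ^ n) (2 ^ n)" "mat_adjoint T = T" "T * T = T"
    using T by (auto simp: is_projection_def)
  have "cnj (T $$ (i, i)) = T $$ (i, i)" if "i < 2 ^ n" for i
    using adjoint_index[of i T i] Tc that by auto
  then have "cnj (ntr T) = ntr T" using Tc(1) by (simp add: ntr_def)
  then have "Im (ntr T) = 0" by (metis Reals_cnj_iff complex_is_Real_iff)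
  then have "(cmod (ntr T))\<^sup>2 = (Re (ntr T))\<^sup>2" by (simp add: cmod_power2)
  moreover have "T ^\<^sub>m 2 = T" using Tc by (simp add: numeral_2_eq_2)
  ultimately show ?thesis by (simp add: var_def mat_abs_projection[OF T] ntrace_emb[OF Tc(1)])
qed

theorem theorem1p10:
  shows "\<exists>K::real. K > 0 \<and>
    (\<forall>(n::nat) (T :: complex mat). n \<ge> 1 \<longrightarrow> is_projection (2 ^ n) T \<longrightarrow>
       var T * sqrt (ln (1 / var T)) \<le> K * Lp_norm 1 (mat_powr (grad_sq n T) (1 / 2)))"
proof (intro exI[of _ 72] conjI allI impI)
  fix n :: nat and T :: "complex mat"
  assume proj: "is_projection (2 ^ n) T"
  let ?N = "2 ^ n :: nat"
  define x where "x = emb ?N T"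
  define A where "A = grad_sq n T"
  have Tc: "T \<in> carrier_mat ?N ?N" "mat_adjoint T = T" "T * T = T"
    using proj by (auto simp: is_projection_def)
  have x: "adj x = x" "x * x = x" "x * unit_of ?N = x"
    using Tc emb_adjoint[OF Tc(1)] emb_mult[OF Tc(1) Tc(1)] by (simp_all add: x_def)
  have Ac: "A \<in> carrier_mat ?N ?N" and embA: "emb ?N A = (\<Sum>p<n. adj (cube.d p x) * cube.d p x)"
    unfolding A_def x_def by (rule emb_grad_sq)+
  have "adj (emb ?N A) = emb ?N A" unfolding embA by (simp add: fmat.star_sum)
  then have "emb ?N (mat_adjoint A) = emb ?N A" by (simp add: emb_adjoint[OF Ac])
  have "mat_adjoint A = A"
  proof (rule eq_matI)
    fix r c assume "r < dim_row A" "c < dim_col A"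
    then show "mat_adjoint A $$ (r, c) = A $$ (r, c)"
      using Ac arg_cong[OF \<open>emb ?N (mat_adjoint A) = emb ?N A\<close>, of "\<lambda>X. entry X r c"] by simp
  qed (use Ac in auto)
  then obtain U d where U: "unitary_mat ?N U" and Ad: "A = U * dg ?N d * mat_adjoint U"
    using hermitian_diagonalization[OF Ac] by blast
  have Uc: "U \<in> carrier_mat ?N ?N" "mat_adjoint U \<in> carrier_mat ?N ?N" and
    U1: "mat_adjoint U * U = 1\<^sub>m ?N" "U * mat_adjoint U = 1\<^sub>m ?N"
    using U by (auto simp: unitary_mat_def)
  define u where "u = emb ?N U"
  have uu: "adj u * u = unit_of ?N" "u * adj u = unit_of ?N"
    using emb_mult[OF Uc] emb_mult[OF Uc(2,1)] by (simp_all add: u_def emb_adjoint[OF Uc(1)] U1)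
  \<comment> \<open>The \<open>p i\<close> below are the rank-one spectral projections of \<open>A\<close>, on the columns of \<open>U\<close>.\<close>
  define q where "q i = emb ?N (dg ?N (\<lambda>k. if k = i then 1 else 0))" for i
  define p where "p i = u * q i * adj u" for i
  have qe: "q i * unit_of ?N = q i" for i by (simp add: q_def)
  have entry_q: "entry (q i) r c = (if r = c \<and> r = i \<and> r < ?N then 1 else 0)" for i r c
    by (auto simp: q_def mat_diag_def)
  have qq: "q i * q j = (if i = j then q i else 0)" for i j
    by (rule fmat_eqI, subst entry_mult[of "{i}"]) (auto simp: entry_q)
  have adj_q: "adj (q i) = q i" for i by (rule fmat_eqI) (auto simp: entry_q)
  have pp: "p i * p j = (if i = j then p i else 0)" for i j
  proof -
    have "p i * p j = u * (q i * (adj u * u)) * q j * adj u" by (simp add: p_def mult.assoc)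
    also have "\<dots> = u * (q i * q j) * adj u" by (simp add: uu qe mult.assoc)
    finally show ?thesis by (simp add: qq p_def)
  qed
  have conj: "emb ?N (U * dg ?N f * mat_adjoint U) = (\<Sum>i<?N. f i *\<^sub>R p i)" for f
  proof -
    have "emb ?N (dg ?N f) = (\<Sum>i<?N. f i *\<^sub>R q i)"
    proof (rule fmat_eqI)
      fix r c
      have "entry (\<Sum>i\<in>J. f i *\<^sub>R q i) r c
        = (\<Sum>i\<in>J. if i = r then if r = c \<and> r < ?N then complex_of_real (f i) else 0 else 0)" for J
        by (induction J rule: infinite_finite_induct) (auto simp: entry_q scaleR_conv_of_real)
      then show "entry (emb ?N (dg ?N f)) r c = entry (\<Sum>i<?N. f i *\<^sub>R q i) r c"
        by (simp add: mat_diag_def sum.delta)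
    qed
    moreover have "emb ?N (U * dg ?N f * mat_adjoint U) = u * emb ?N (dg ?N f) * adj u"
      using Uc by (simp add: emb_mult mult_carrier_mat[of _ ?N ?N _ ?N] emb_adjoint u_def)
    ultimately show ?thesis by (simp add: p_def sum_distrib_left sum_distrib_right)
  qed
  have tr_p: "ntrace n (p i) = 1 / ?N" if "i < ?N" for i
  proof -
    have "Tr (p i) = Tr (q i * (adj u * u))" unfolding p_def by (metis Tr_commute mult.assoc)
    also have "\<dots> = (\<Sum>r<?N. entry (q i) r r)"
      unfolding uu qe by (rule Tr_eq) (auto simp: entry_q)
    also have "\<dots> = 1" using that by (simp add: entry_q)
    finally show ?thesis by (simp add: ntrace_def)
  qed
  have adj_p: "adj (p i) = p i" for i by (simp add: p_def adj_q fmat.star_mult fmat.star_star mult.assoc)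
  have sum_p: "(\<Sum>i<?N. p i) = unit_of ?N"
    using conj[of "\<lambda>_. 1"] U1 Uc by (simp add: mat_diag_one)
  have pAp: "p i * emb ?N A * p i = d i *\<^sub>R p i" if "i < ?N" for i
    unfolding Ad conj
    using that by (simp add: sum_distrib_left sum_distrib_right pp if_distrib if_distribR cong: if_cong)
  have d: "0 \<le> d i" if "i < ?N" for i
  proof -
    have "d i * ntrace n (p i) = (\<Sum>k<n. ntrace n (adj (cube.d k x * p i) * (cube.d k x * p i)))"
      using arg_cong[OF pAp[OF that], of "ntrace n"] unfolding embA
      by (simp add: sum_distrib_left sum_distrib_right fmat.tr_sum fmat.star_mult adj_p mult.assoc fmat.tr_scaleR)
    also have "\<dots> \<ge> 0" by (intro sum_nonneg fmat.tr_square_nonneg)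
    finally show ?thesis using tr_p[OF that] by (simp add: zero_le_divide_iff power_le_zero_eq)
  qed
  let ?S = "U * dg ?N (\<lambda>i. sqrt (d i)) * mat_adjoint U"
  have trS: "Re (ntr ?S) = (\<Sum>i<?N. sqrt (d i) * ntrace n (p i))"
    unfolding ntrace_emb[OF unitary_conj_carrier[OF U], symmetric] conj
    by (simp add: fmat.tr_sum fmat.tr_scaleR)
  have "0 \<le> Re (ntr ?S)" unfolding trS by (intro sum_nonneg) (auto simp: tr_p d)
  then have norm: "Lp_norm 1 (mat_powr A (1 / 2)) = (\<Sum>i<?N. sqrt (d i) * ntrace n (p i))"
    unfolding Ad trS[symmetric] using d by (intro Lp_norm_1_sqrt[OF U]) auto
  show "var T * sqrt (ln (1 / var T)) \<le> 72 * Lp_norm 1 (mat_powr (grad_sq n T) (1 / 2))"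
    unfolding A_def[symmetric] norm var_projection[OF proj] x_def[symmetric]
  proof (rule cube.projection_isoperimetry[OF x])
    show "unit_of ?N * p i = p i" if "i \<in> {..<?N}" for i
      unfolding sum_p[symmetric] sum_distrib_right using that by (simp add: pp)
    show "ntrace n (p i * (\<Sum>j<n. adj (cube.d j x) * cube.d j x) * p i) = (sqrt (d i))\<^sup>2 * ntrace n (p i)"
      if "i \<in> {..<?N}" for i
      using that pAp[of i] d[of i] by (simp add: embA[symmetric] fmat.tr_scaleR)
  qed (use d in \<open>auto simp: adj_p pp sum_p\<close>)
qed simp

end
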